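(* Let $\Sigma$ be a switched linear differential system with modes $\mathfrak{B}_k=\ker R_k(\frac{d}{dt})$, $k=1,\ldots,N$, where $R_k\in\mathbb{R}^{\tt w\times\tt w}[\xi]$ is nonsingular and $\mathfrak{B}_k$ is asymptotically stable. Let $n_k=\deg\det R_k$, let $X_k\in\mathbb{R}^{n_k\times\tt w}[\xi]$ be a minimal state map for $\mathfrak{B}_k$, write $R_k(\xi)=\sum_{i=0}^{L_k}R_{k,i}\xi^i$, $X_k(\xi)=\sum_{i=0}^{L_k-1}X_{k,i}\xi^i$, and set $\widetilde{R}_k:=[R_{k,0}\ \cdots\ R_{k,L_k}]$, $\widetilde{X}_k:=[X_{k,0}\ \cdots\ X_{k,L_k-1}]$. Denote the roots of $\det R_k(\xi)$ (counted with multiplicity) by $\lambda_{k,i}$, $i=1,\ldots,n_k$, assume that the algebraic multiplicity of each $\lambda_{k,i}$ equals $\dim\ker R_k(\lambda_{k,i})$, and let $w_{k,i}\in\mathbb{C}^{\tt w}$ satisfy $R_k(\lambda_{k,i})w_{k,i}=0$, with the $w_{k,i}$ associated with equal $\lambda_{k,i}$ linearly independent. Define $V_k:=[X_k(\lambda_{k,1})w_{k,1}\ \cdots\ X_k(\lambda_{k,n_k})w_{k,n_k}]\in\mathbb{C}^{n_k\times n_k}$, and let $L_{k\to\ell}$, $k\neq\ell$, be the re-initialisation maps of $\Sigma$. If there exist $\overline{K}_k\in\mathbb{R}^{n_k\times n_k}$, $\overline{Y}_k\in\mathbb{R}^{\tt w\times n_k}$, $k=1,\ldots,N$, such that $$\widetilde{\Phi}_k:=\begin{bmatrix}0_{\tt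 w\times n_k}\\ \widetilde{X}_k^\top\end{bmatrix}\overline{K}_k\begin{bmatrix}\widetilde{X}_k&0_{n_k\times\tt w}\end{bmatrix}+\begin{bmatrix}\widetilde{X}_k^\top\\0_{\tt w\times n_k}\end{bmatrix}\overline{K}_k\begin{bmatrix}0_{n_k\times\tt w}&\widetilde{X}_k\end{bmatrix}-\begin{bmatrix}\widetilde{X}_k^\top\\0_{\tt w\times n_k}\end{bmatrix}\overline{Y}_k^\top\widetilde{R}_k-\widetilde{R}_k^\top\overline{Y}_k\begin{bmatrix}\widetilde{X}_k&0_{n_k\times\tt w}\end{bmatrix}\leq0,$$ then there exist $\overline{F}_k\in\mathbb{R}^{n_k\times n_k}$ such that $\widetilde{\Phi}_k=\begin{bmatrix}\widetilde{X}_k^\top\\0_{\tt w\times n_k}\end{bmatrix}\overline{F}_k\begin{bmatrix}\widetilde{X}_k&0_{n_k\times\tt w}\end{bmatrix}$, $k=1,\ldots,N$. Moreover, if for all $k,\ell=1,\ldots,N$, $\ell\neq k$, $$\overline{F}_k<0\quad\text{and}\quad V_k^*\overline{K}_kV_k\geq V_k^*L_{k\to\ell}^\top\overline{K}_\ell L_{k\to\ell}V_k,$$ then $\Sigma$ is asymptotically stable and $\{X_k(\zeta)^\top\overline{K}_kX_k(\eta)\}_{k=1,\ldots,N}$ induces a multiple Lyapunov function for $\Sigma$.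
   Context: Behaviours: $\ker R(\frac{d}{dt})=\{w\in C^\infty(\mathbb{R},\mathbb{R}^{\tt w}):R(\frac{d}{dt})w=0\}$. A minimal state map for $\ker R(\frac{d}{dt})$ ($R$ nonsingular) is a matrix $X\in\mathbb{R}^{n\times\tt w}[\xi]$, $n=\deg\det R$, whose rows form a basis of the real vector space $\{f\in\mathbb{R}^{1\times\tt w}[\xi]: fR^{-1}\text{ strictly proper}\}$. For nonsingular $R$, $f\bmod R:=sR$ where $fR^{-1}=s+p$, $s$ strictly proper rational, $p$ polynomial (rowwise for matrices). SLDS: $\Sigma=\{\mathcal{P},\mathcal{F},\mathcal{S},\mathcal{G}\}$ with $\mathcal{P}=\{1,\ldots,N\}$, modes $\mathcal{F}=\{\mathfrak{B}_1,\ldots,\mathfrak{B}_N\}$ (autonomous), switching signals $\mathcal{S}$ = piecewise constant right-continuous $s:\mathbb{R}\to\mathcal{P}$ with finitely many switching instants $t_1<t_2<\cdots$ (points where $s$ jumps) in bounded intervals, and gluing conditions $(G^-_{k\to\ell},G^+_{k\to\ell})$, polynomial matrices with $\tt w$ columns, $k\neq\ell$. The switched behaviour $\mathfrak{B}^\Sigma$ consists of all $w$ such that for some $s\in\mathcal{S}$, on each $[t_i,t_{i+1})$ $w$ agrees with a trajectory of $\mathfrak{B}_{s(t_i)}$, and $G^+_{s(t_{i-1})\to s(t_i)}(\frac{d}{dt})w(t_i^+)=G^-_{s(t_{i-1})\to s(t_i)}(\frac{d}{dt})w(t_i^-)$ at each switching instant. $\Sigma$ is asymptotically stable if $w(t)\to0$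 as $t\to\infty$ for all $w\in\mathfrak{B}^\Sigma$. Re-initialisation maps: there are constant matrices $F^\pm_{k\to\ell}$ with $G^-_{k\to\ell}\bmod R_k=F^-_{k\to\ell}X_k$ and $G^+_{k\to\ell}\bmod R_\ell=F^+_{k\to\ell}X_\ell$. Standing assumption: the gluing conditions are well-posed, meaning $F^-_{k\to\ell}v_k=F^+_{k\to\ell}v_\ell$ has at most one solution $v_\ell$ for each $v_k$ (so $F^+_{k\to\ell}$ has full column rank); the re-initialisation map is $L_{k\to\ell}:=F^{+*}_{k\to\ell}F^-_{k\to\ell}$ for a fixed left inverse $F^{+*}_{k\to\ell}$ of $F^+_{k\to\ell}$. QDFs: $\Psi(\zeta,\eta)=\sum\Psi_{h,k}\zeta^h\eta^k$ induces $Q_\Psi(w)=\sum(\frac{d^hw}{dt^h})^\top\Psi_{h,k}\frac{d^kw}{dt^k}$. A multiple Lyapunov function for $\Sigma$ is a family of QDFs $Q_{\Psi_i}$, $i=1,\ldots,N$, with $Q_{\Psi_i}\ge0$ along $\mathfrak{B}_i$, $\frac{d}{dt}Q_{\Psi_i}<0$ along $\mathfrak{B}_i$ (i.e. $\le0$ and vanishing only for $w=0$), and $Q_{\Psi_{s(t_{j-1})}}(w)(t_j^-)\ge Q_{\Psi_{s(t_j)}}(w)(t_j^+)$ for every $w\in\mathfrak{B}^\Sigma$ and switching instant $t_j$. $V^*$ is the conjugate transpose. *)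

theory Defs
  imports Complex_Main
    "Jordan_Normal_Form.Jordan_Normal_Form"
    "Jordan_Normal_Form.Schur_Decomposition"
    "Jordan_Normal_Form.Matrix_Kernel"
begin

definition rderiv :: "(real \<Rightarrow> real) \<Rightarrow> real \<Rightarrow> real" where
  "rderiv f x = (SOME D. (f has_real_derivative D) (at x))"

definition nderiv :: "nat \<Rightarrow> (real \<Rightarrow> real) \<Rightarrow> real \<Rightarrow> real" where
  "nderiv k f = (rderiv ^^ k) f"

definition smooth_fun :: "(real \<Rightarrow> real) \<Rightarrow> bool" where
  "smooth_fun f \<longleftrightarrow> (\<forall>k x. nderiv k f differentiable (at x))"

type_synonym traj = "real \<Rightarrow> real vec"

definition dvec :: "nat \<Rightarrow> traj \<Rightarrow> real \<Rightarrow> real vec" where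
  "dvec k w t = vec (dim_vec (w t)) (\<lambda>j. nderiv k (\<lambda>s. w s $ j) t)"

definition pdo :: "real poly mat \<Rightarrow> traj \<Rightarrow> real \<Rightarrow> real vec" where
  "pdo P w t = vec (dim_row P) (\<lambda>i. \<Sum>j<dim_col P. \<Sum>k\<le>degree (P $$ (i,j)).
      coeff (P $$ (i,j)) k * nderiv k (\<lambda>s. w s $ j) t)"

definition behaviour :: "real poly mat \<Rightarrow> traj set" where
  "behaviour R = {w. (\<forall>t. dim_vec (w t) = dim_col R) \<and>
      (\<forall>j<dim_col R. smooth_fun (\<lambda>t. w t $ j)) \<and>
      (\<forall>t. pdo R w t = 0\<^sub>v (dim_row R))}"

definition tends_to_zero :: "nat \<Rightarrow> traj \<Rightarrow> bool" where
  "tends_to_zero wd w \<longleftrightarrow> (\<forall>j<wd. ((\<lambda>t. w t $ j) \<longlongrightarrow> 0) at_top)"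

definition beh_asympt_stable :: "real poly mat \<Rightarrow> bool" where
  "beh_asympt_stable R \<longleftrightarrow> (\<forall>w\<in>behaviour R. tends_to_zero (dim_col R) w)"

definition pmat_degree :: "real poly mat \<Rightarrow> nat" where
  "pmat_degree P = Max (insert 0 {degree (P $$ (i,j)) |i j. i < dim_row P \<and> j < dim_col P})"

definition coeff_mat :: "real poly mat \<Rightarrow> nat \<Rightarrow> real mat" where
  "coeff_mat P i = mat (dim_row P) (dim_col P) (\<lambda>(a,b). coeff (P $$ (a,b)) i)"

definition coeff_stack :: "real poly mat \<Rightarrow> nat \<Rightarrow> real mat" where
  "coeff_stack P m = mat (dim_row P) (m * dim_col P)
      (\<lambda>(a,b). coeff (P $$ (a, b mod dim_col P)) (b div dim_col P))"

definition const_pmat :: "real mat \<Rightarrow> real poly mat" where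
  "const_pmat F = map_mat (\<lambda>c. [:c:]) F"

definition peval_c :: "real poly mat \<Rightarrow> complex \<Rightarrow> complex mat" where
  "peval_c P z = map_mat (\<lambda>p. poly (map_poly complex_of_real p) z) P"

text \<open>f R^{-1} strictly proper, for a polynomial row f (written with R^{-1} = adj R / det R):
  each entry q/det R of f R^{-1} has q = 0 or deg q < deg det R.\<close>
definition strictly_proper_row :: "real poly vec \<Rightarrow> real poly mat \<Rightarrow> bool" where
  "strictly_proper_row f R \<longleftrightarrow> (\<forall>j<dim_col R.
     (let q = (\<Sum>i<dim_row R. f $ i * adj_mat R $$ (i,j)) in q = 0 \<or> degree q < degree (det R)))"

definition state_space :: "real poly mat \<Rightarrow> real poly vec set" where
  "state_space R = {f. dim_vec f = dim_col R \<and> strictly_proper_row f R}"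

definition minimal_state_map :: "real poly mat \<Rightarrow> real poly mat \<Rightarrow> bool" where
  "minimal_state_map X R \<longleftrightarrow>
     dim_row X = degree (det R) \<and> dim_col X = dim_col R \<and>
     (\<forall>i<dim_row X. row X i \<in> state_space R) \<and>
     (\<forall>c::nat \<Rightarrow> real. (\<forall>j<dim_col X. (\<Sum>i<dim_row X. Polynomial.smult (c i) (X $$ (i,j))) = 0)
          \<longrightarrow> (\<forall>i<dim_row X. c i = 0)) \<and>
     (\<forall>f\<in>state_space R. \<exists>c::nat \<Rightarrow> real.
          \<forall>j<dim_col X. f $ j = (\<Sum>i<dim_row X. Polynomial.smult (c i) (X $$ (i,j))))"

text \<open>G mod R = s R where G R^{-1} = s + p (s strictly proper, p polynomial), i.e. G - p R,
  with p = entrywise polynomial part of G adj(R) / det R.\<close>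
definition pmat_mod :: "real poly mat \<Rightarrow> real poly mat \<Rightarrow> real poly mat" where
  "pmat_mod G R = G - map_mat (\<lambda>q. q div det R) (G * adj_mat R) * R"

definition neg_semidef :: "real mat \<Rightarrow> bool" where
  "neg_semidef A \<longleftrightarrow> A \<in> carrier_mat (dim_row A) (dim_row A) \<and> transpose_mat A = A \<and>
     (\<forall>x\<in>carrier_vec (dim_row A). x \<bullet> (A *\<^sub>v x) \<le> 0)"

definition neg_def :: "real mat \<Rightarrow> bool" where
  "neg_def A \<longleftrightarrow> A \<in> carrier_mat (dim_row A) (dim_row A) \<and> transpose_mat A = A \<and>
     (\<forall>x\<in>carrier_vec (dim_row A). x \<noteq> 0\<^sub>v (dim_row A) \<longrightarrow> x \<bullet> (A *\<^sub>v x) < 0)"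

definition herm_psd :: "complex mat \<Rightarrow> bool" where
  "herm_psd A \<longleftrightarrow> A \<in> carrier_mat (dim_row A) (dim_row A) \<and> mat_adjoint A = A \<and>
     (\<forall>x\<in>carrier_vec (dim_row A). 0 \<le> Re (conjugate x \<bullet> (A *\<^sub>v x)))"

definition herm_geq :: "complex mat \<Rightarrow> complex mat \<Rightarrow> bool" where
  "herm_geq A B \<longleftrightarrow> dim_row A = dim_row B \<and> dim_col A = dim_col B \<and> herm_psd (A - B)"

definition cmat :: "real mat \<Rightarrow> complex mat" where
  "cmat A = map_mat complex_of_real A"

definition hcat :: "'a::zero mat \<Rightarrow> 'a mat \<Rightarrow> 'a mat" where
  "hcat A B = four_block_mat A B (0\<^sub>m 0 (dim_col A)) (0\<^sub>m 0 (dim_col B))"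

definition Rtil :: "real poly mat \<Rightarrow> real mat" where
  "Rtil R = coeff_stack R (pmat_degree R + 1)"

definition Xtil :: "real poly mat \<Rightarrow> real poly mat \<Rightarrow> real mat" where
  "Xtil R X = coeff_stack X (pmat_degree R)"

definition blk_X0 :: "real poly mat \<Rightarrow> real poly mat \<Rightarrow> real mat" where
  "blk_X0 R X = hcat (Xtil R X) (0\<^sub>m (dim_row X) (dim_col R))"
definition blk_0X :: "real poly mat \<Rightarrow> real poly mat \<Rightarrow> real mat" where
  "blk_0X R X = hcat (0\<^sub>m (dim_row X) (dim_col R)) (Xtil R X)"
definition blk_0XT :: "real poly mat \<Rightarrow> real poly mat \<Rightarrow> real mat" where
  "blk_0XT R X = (0\<^sub>m (dim_col R) (dim_row X)) @\<^sub>r transpose_mat (Xtil R X)"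
definition blk_XT0 :: "real poly mat \<Rightarrow> real poly mat \<Rightarrow> real mat" where
  "blk_XT0 R X = transpose_mat (Xtil R X) @\<^sub>r (0\<^sub>m (dim_col R) (dim_row X))"

definition Phi_tilde :: "real poly mat \<Rightarrow> real poly mat \<Rightarrow> real mat \<Rightarrow> real mat \<Rightarrow> real mat" where
  "Phi_tilde R X K Y =
     blk_0XT R X * K * blk_X0 R X + blk_XT0 R X * K * blk_0X R X
     - blk_XT0 R X * transpose_mat Y * Rtil R - transpose_mat (Rtil R) * Y * blk_X0 R X"

definition Vmat :: "real poly mat \<Rightarrow> (nat \<Rightarrow> complex) \<Rightarrow> (nat \<Rightarrow> complex vec) \<Rightarrow> complex mat" where
  "Vmat X lam wv = mat (dim_row X) (dim_row X) (\<lambda>(a,i). (peval_c X (lam i) *\<^sub>v wv i) $ a)"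

definition switch_points :: "(real \<Rightarrow> nat) \<Rightarrow> real set" where
  "switch_points s = {t. \<not> (\<exists>e>0. \<forall>x. \<bar>x - t\<bar> < e \<longrightarrow> s x = s t)}"

definition switching_signal :: "nat \<Rightarrow> (real \<Rightarrow> nat) \<Rightarrow> bool" where
  "switching_signal N s \<longleftrightarrow> (\<forall>t. s t \<in> {1..N}) \<and>
     (\<forall>t. \<exists>e>0. \<forall>x. t \<le> x \<and> x < t + e \<longrightarrow> s x = s t) \<and>
     (\<forall>a b. finite (switch_points s \<inter> {a..b}))"

text \<open>w is a switched trajectory with switching signal s; W t is the trajectory of mode s t
  with which w agrees on the inter-switching interval containing t.\<close>
definition sw_traj :: "nat \<Rightarrow> (nat \<Rightarrow> real poly mat) \<Rightarrow> (nat \<Rightarrow> nat \<Rightarrow> real poly mat)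
    \<Rightarrow> (nat \<Rightarrow> nat \<Rightarrow> real poly mat) \<Rightarrow> (real \<Rightarrow> nat) \<Rightarrow> (real \<Rightarrow> traj) \<Rightarrow> traj \<Rightarrow> bool" where
  "sw_traj N R Gm Gp s W w \<longleftrightarrow> switching_signal N s \<and>
     (\<forall>t. W t \<in> behaviour (R (s t))) \<and>
     (\<forall>t t'. t < t' \<and> switch_points s \<inter> {t<..t'} = {} \<longrightarrow> W t = W t') \<and>
     (\<forall>t. w t = W t t) \<and>
     (\<forall>\<tau>\<in>switch_points s. \<forall>t<\<tau>. switch_points s \<inter> {t<..<\<tau>} = {} \<longrightarrow>
        pdo (Gp (s t) (s \<tau>)) (W \<tau>) \<tau> = pdo (Gm (s t) (s \<tau>)) (W t) \<tau>)"

definition switched_behaviour :: "nat \<Rightarrow> (nat \<Rightarrow> real poly mat) \<Rightarrow> (nat \<Rightarrow> nat \<Rightarrow> real poly mat)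
    \<Rightarrow> (nat \<Rightarrow> nat \<Rightarrow> real poly mat) \<Rightarrow> traj set" where
  "switched_behaviour N R Gm Gp = {w. \<exists>s W. sw_traj N R Gm Gp s W w}"

definition sw_asympt_stable :: "nat \<Rightarrow> nat \<Rightarrow> (nat \<Rightarrow> real poly mat) \<Rightarrow> (nat \<Rightarrow> nat \<Rightarrow> real poly mat)
    \<Rightarrow> (nat \<Rightarrow> nat \<Rightarrow> real poly mat) \<Rightarrow> bool" where
  "sw_asympt_stable wd N R Gm Gp \<longleftrightarrow> (\<forall>w\<in>switched_behaviour N R Gm Gp. tends_to_zero wd w)"

text \<open>A two-variable polynomial matrix Psi(zeta,eta) = sum_{h,k<=d} Psi h k zeta^h eta^k and
  its QDF Q_Psi(w) = sum (w^(h))^T Psi h k w^(k).\<close>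
definition qdf :: "(nat \<Rightarrow> nat \<Rightarrow> real mat) \<Rightarrow> nat \<Rightarrow> traj \<Rightarrow> real \<Rightarrow> real" where
  "qdf Psi d w t = (\<Sum>h\<le>d. \<Sum>k\<le>d. dvec h w t \<bullet> (Psi h k *\<^sub>v dvec k w t))"

text \<open>Coefficients of X(zeta)^T K X(eta).\<close>
definition psi_X :: "real poly mat \<Rightarrow> real mat \<Rightarrow> nat \<Rightarrow> nat \<Rightarrow> real mat" where
  "psi_X X K h k = transpose_mat (coeff_mat X h) * K * coeff_mat X k"

definition multiple_lyapunov :: "nat \<Rightarrow> (nat \<Rightarrow> real poly mat) \<Rightarrow> (nat \<Rightarrow> nat \<Rightarrow> real poly mat)
    \<Rightarrow> (nat \<Rightarrow> nat \<Rightarrow> real poly mat) \<Rightarrow> (nat \<Rightarrow> nat \<Rightarrow> nat \<Rightarrow> real mat) \<Rightarrow> (nat \<Rightarrow> nat) \<Rightarrow> bool" where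
  "multiple_lyapunov N R Gm Gp Psi d \<longleftrightarrow>
     (\<forall>i\<in>{1..N}. \<forall>w\<in>behaviour (R i). \<forall>t. 0 \<le> qdf (Psi i) (d i) w t) \<and>
     (\<forall>i\<in>{1..N}. \<forall>w\<in>behaviour (R i). \<forall>t. rderiv (qdf (Psi i) (d i) w) t \<le> 0) \<and>
     (\<forall>i\<in>{1..N}. \<forall>w\<in>behaviour (R i).
        (\<forall>t. rderiv (qdf (Psi i) (d i) w) t = 0) \<longrightarrow> (\<forall>t. w t = 0\<^sub>v (dim_col (R i)))) \<and>
     (\<forall>s W w. sw_traj N R Gm Gp s W w \<longrightarrow>
        (\<forall>\<tau>\<in>switch_points s. \<forall>t<\<tau>. switch_points s \<inter> {t<..<\<tau>} = {} \<longrightarrow>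
           qdf (Psi (s \<tau>)) (d (s \<tau>)) (W \<tau>) \<tau> \<le> qdf (Psi (s t)) (d (s t)) (W t) \<tau>))"

end

theory Submission
  imports Defs
begin

text \<open>
  Modulo the row module of \<open>R\<close> every polynomial row is a constant combination of the rows of \<open>X\<close>.
  Hence along a mode the state \<open>x = X(d/dt) w\<close> satisfies \<open>x' = A x\<close>, \<open>w = C x\<close>, and a gluing
  condition becomes \<open>F\<^sup>+ x(\<tau>\<^sup>+) = F\<^sup>- x(\<tau>\<^sup>-)\<close>, i.e. \<open>x(\<tau>\<^sup>+) = L x(\<tau>\<^sup>-)\<close>.

  The form of \<open>\<Phi>\<close> vanishes on the kernel of \<open>[X 0]\<close>; being semidefinite, \<open>\<Phi>\<close> vanishes there
  itself and so factors through \<open>[X 0]\<close>, which has full row rank. Evaluated on the jet of a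
  trajectory, \<open>\<Phi>\<close> is the derivative of \<open>Q = x\<^sup>T K x\<close>, so \<open>Q' = x\<^sup>T F x \<le> - e |x|\<^sup>2\<close>. Since \<open>x' = A x\<close>,
  \<open>Q - \<delta> |x|\<^sup>2\<close> is nonincreasing for small \<open>\<delta>\<close>, and it tends to 0 by stability of the mode; thus
  \<open>Q \<ge> \<delta> |x|\<^sup>2\<close>, and \<open>Q\<close> decays exponentially within a mode.

  The columns of \<open>V\<close> are eigenvectors of \<open>A\<close>, and \<open>V\<close> is invertible; so the inequality with \<open>V\<close> says
  that \<open>Q\<close> does not increase at switching instants, and the exponential decay is global.
\<close>

subsection \<open>Linear differential operators\<close>

lemma rderiv_eq:
  assumes "(f has_real_derivative D) (at t)"
  shows "rderiv f t = D"
  unfolding rderiv_def using assms DERIV_unique by (intro some_equality) blast+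

lemma nderiv_0 [simp]: "nderiv 0 f = f"
  by (simp add: nderiv_def)

lemma nderiv_Suc: "nderiv (Suc k) f = rderiv (nderiv k f)"
  by (simp add: nderiv_def)

lemma nderiv_nderiv: "nderiv j (nderiv k f) = nderiv (j + k) f"
  by (simp add: nderiv_def funpow_add)

lemma nderiv_has_derivative:
  assumes "smooth_fun f"
  shows "(nderiv k f has_real_derivative nderiv (Suc k) f t) (at t)"
proof -
  have "nderiv k f differentiable (at t)"
    using assms by (simp add: smooth_fun_def)
  then obtain D where "(nderiv k f has_real_derivative D) (at t)"
    by (auto simp: real_differentiable_def)
  with rderiv_eq[OF this] show ?thesis
    by (simp add: nderiv_Suc)
qed

lemma smooth_nderiv: "smooth_fun f \<Longrightarrow> smooth_fun (nderiv k f)"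
  by (simp add: smooth_fun_def nderiv_nderiv)

text \<open>\<open>rderiv\<close> picks an arbitrary value where no derivative exists, so linearity
  rests on smoothness of every summand at every order.\<close>

lemma nderiv_lincomb:
  assumes "finite I" "\<And>i. i \<in> I \<Longrightarrow> smooth_fun (f i)"
  shows "nderiv k (\<lambda>t. \<Sum>i\<in>I. c i * f i t) = (\<lambda>t. \<Sum>i\<in>I. c i * nderiv k (f i) t)"
proof (induction k)
  case (Suc k)
  have "((\<lambda>t. \<Sum>i\<in>I. c i * nderiv k (f i) t) has_real_derivative
          (\<Sum>i\<in>I. c i * nderiv (Suc k) (f i) t)) (at t)" for t
    by (intro DERIV_sum DERIV_cmult nderiv_has_derivative assms)
  then show ?case
    unfolding nderiv_Suc[of k "\<lambda>t. \<Sum>i\<in>I. c i * f i t"] Suc by (intro ext rderiv_eq)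
qed simp

lemma smooth_lincomb:
  assumes "finite I" "\<And>i. i \<in> I \<Longrightarrow> smooth_fun (f i)"
  shows "smooth_fun (\<lambda>t. \<Sum>i\<in>I. c i * f i t)"
  unfolding smooth_fun_def
proof (intro allI)
  fix k t
  have "((\<lambda>t. \<Sum>i\<in>I. c i * nderiv k (f i) t) has_real_derivative
          (\<Sum>i\<in>I. c i * nderiv (Suc k) (f i) t)) (at t)"
    by (intro DERIV_sum DERIV_cmult nderiv_has_derivative assms)
  then show "nderiv k (\<lambda>t. \<Sum>i\<in>I. c i * f i t) differentiable (at t)"
    unfolding real_differentiable_def
    by (subst nderiv_lincomb) (use assms in auto)
qed

lemma nderiv_sum:
  assumes "finite I" "\<And>i. i \<in> I \<Longrightarrow> smooth_fun (f i)"
  shows "nderiv k (\<lambda>t. \<Sum>i\<in>I. f i t) = (\<lambda>t. \<Sum>i\<in>I. nderiv k (f i) t)"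
  using nderiv_lincomb[of I f k "\<lambda>_. 1"] assms by simp

lemma nderiv_zero: "nderiv k (\<lambda>_. 0) = (\<lambda>_. 0)"
  using nderiv_sum[of "{}" "\<lambda>_ _. 0" k] by simp

text \<open>The action of a scalar polynomial as \<open>p(d/dt)\<close>. On smooth functions it is a
  module structure (\<open>dop_add\<close>, \<open>dop_mult\<close>), which turns identities between
  polynomial rows into identities between trajectories.\<close>

definition dop :: "real poly \<Rightarrow> (real \<Rightarrow> real) \<Rightarrow> real \<Rightarrow> real" where
  "dop p f t = (\<Sum>k\<le>degree p. coeff p k * nderiv k f t)"

text \<open>Coefficients beyond the degree are zero, so polynomials of different degrees can share
  one summation range.\<close>

lemma dop_eq_sum:
  assumes "degree p < d"
  shows "dop p f t = (\<Sum>k<d. coeff p k * nderiv k f t)"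
  unfolding dop_def
  by (intro sum.mono_neutral_left) (use assms in \<open>auto simp: coeff_eq_0\<close>)

lemma dop_0 [simp]: "dop 0 f t = 0"
  by (simp add: dop_def)

lemma dop_add: "dop (p + q) f t = dop p f t + dop q f t"
proof -
  let ?d = "Suc (max (degree p) (degree q))"
  have "degree (p + q) < ?d"
    using degree_add_le_max[of p q] by (simp add: less_Suc_eq_le)
  then show ?thesis
    by (subst (1 2 3) dop_eq_sum[of _ ?d]) (auto simp: sum.distrib algebra_simps)
qed

lemma dop_smult: "dop (Polynomial.smult c p) f t = c * dop p f t"
  by (subst (1 2) dop_eq_sum[of _ "Suc (degree p)"])
     (auto simp: sum_distrib_left algebra_simps less_Suc_eq_le degree_smult_le)

lemma dop_sum: "dop (\<Sum>i\<in>I. p i) f t = (\<Sum>i\<in>I. dop (p i) f t)"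
  by (induction I rule: infinite_finite_induct) (auto simp: dop_add)

lemma dop_zero_fun [simp]: "dop p (\<lambda>_. 0) t = 0"
  by (simp add: dop_def nderiv_zero)

lemma dop_1 [simp]: "dop 1 f t = f t"
  by (simp add: dop_def)

lemma dop_pCons: "dop (pCons a p) f t = a * f t + dop p (nderiv 1 f) t"
proof -
  have "dop (pCons a p) f t = (\<Sum>k<Suc (Suc (degree p)). coeff (pCons a p) k * nderiv k f t)"
    by (intro dop_eq_sum) (simp add: less_Suc_eq_le degree_pCons_le)
  also have "\<dots> = a * f t + (\<Sum>k<Suc (degree p). coeff p k * nderiv k (nderiv 1 f) t)"
    by (subst sum.lessThan_Suc_shift) (simp add: nderiv_nderiv)
  also have "(\<Sum>k<Suc (degree p). coeff p k * nderiv k (nderiv 1 f) t) = dop p (nderiv 1 f) t"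
    by (rule dop_eq_sum[symmetric]) simp
  finally show ?thesis .
qed

lemma nderiv_dop:
  assumes "smooth_fun f"
  shows "nderiv k (dop p f) = dop p (nderiv k f)"
proof -
  have "nderiv k (\<lambda>t. \<Sum>i\<le>degree p. coeff p i * nderiv i f t)
      = (\<lambda>t. \<Sum>i\<le>degree p. coeff p i * nderiv k (nderiv i f) t)"
    by (intro nderiv_lincomb smooth_nderiv assms) simp
  then show ?thesis
    unfolding dop_def[abs_def] by (simp add: nderiv_nderiv add.commute)
qed

lemma smooth_dop:
  assumes "smooth_fun f"
  shows "smooth_fun (dop p f)"
  unfolding dop_def[abs_def] by (intro smooth_lincomb smooth_nderiv assms) simp

lemma dop_has_derivative:
  assumes "smooth_fun f"
  shows "(dop p f has_real_derivative dop (pCons 0 p) f t) (at t)"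
  using nderiv_has_derivative[OF smooth_dop[OF assms], of 0 p t] nderiv_dop[OF assms, of 1 p]
  by (simp add: dop_pCons)

text \<open>Induction on \<open>p\<close>: splitting off the constant coefficient leaves a factor
  d/dt, which commutes with \<open>dop q\<close> on smooth functions.\<close>

lemma dop_mult:
  assumes "smooth_fun f"
  shows "dop (p * q) f t = dop p (dop q f) t"
  using assms
proof (induction p arbitrary: f t)
  case (pCons a p)
  have "dop (pCons a p * q) f t = a * dop q f t + dop (p * q) (nderiv 1 f) t"
    by (simp add: dop_add dop_smult dop_pCons)
  also have "\<dots> = a * dop q f t + dop p (nderiv 1 (dop q f)) t"
    by (simp add: pCons.IH[OF smooth_nderiv[OF pCons.prems]] nderiv_dop[OF pCons.prems])
  finally show ?case
    by (simp add: dop_pCons)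
qed simp

lemma dop_sum_fun:
  assumes "finite I" "\<And>i. i \<in> I \<Longrightarrow> smooth_fun (f i)"
  shows "dop p (\<lambda>t. \<Sum>i\<in>I. f i t) t = (\<Sum>i\<in>I. dop p (f i) t)"
proof -
  have "nderiv k (\<lambda>t. \<Sum>i\<in>I. f i t) = (\<lambda>t. \<Sum>i\<in>I. nderiv k (f i) t)" for k
    by (intro nderiv_sum assms)
  then show ?thesis
    unfolding dop_def by (simp only: sum_distrib_left) (rule sum.swap)
qed

section \<open>Trajectories of a single mode and their decay\<close>

lemma pdo_index:
  assumes "i < dim_row P"
  shows "pdo P w t $ i = (\<Sum>j<dim_col P. dop (P $$ (i, j)) (\<lambda>s. w s $ j) t)"
  using assms by (simp add: pdo_def dop_def)

lemma dim_pdo [simp]: "dim_vec (pdo P w t) = dim_row P"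
  by (simp add: pdo_def)

lemma behaviour_smooth: "w \<in> behaviour R \<Longrightarrow> j < dim_col R \<Longrightarrow> smooth_fun (\<lambda>t. w t $ j)"
  by (simp add: behaviour_def)

lemma behaviour_eq:
  assumes "w \<in> behaviour R" "i < dim_row R"
  shows "(\<Sum>j<dim_col R. dop (R $$ (i, j)) (\<lambda>s. w s $ j) t) = 0"
  using assms pdo_index[OF assms(2), of w t] by (simp add: behaviour_def)

text \<open>The operator has constant coefficients, so it commutes with d/dt.\<close>

lemma dvec_Suc_behaviour:
  assumes w: "w \<in> behaviour R"
  shows "dvec 1 w \<in> behaviour R"
proof -
  have dim: "dim_vec (w t) = dim_col R" for t
    using w by (simp add: behaviour_def)
  have nth: "(\<lambda>t. dvec 1 w t $ j) = nderiv 1 (\<lambda>s. w s $ j)" if "j < dim_col R" for j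
    using that by (auto simp: dvec_def dim)
  have "pdo R (dvec 1 w) t $ i = 0" if i: "i < dim_row R" for i t
  proof -
    have "pdo R (dvec 1 w) t $ i = (\<Sum>j<dim_col R. nderiv 1 (dop (R $$ (i, j)) (\<lambda>s. w s $ j)) t)"
      using i by (simp add: pdo_index nth nderiv_dop behaviour_smooth[OF w] del: One_nat_def)
    also have "\<dots> = nderiv 1 (\<lambda>t. \<Sum>j<dim_col R. dop (R $$ (i, j)) (\<lambda>s. w s $ j) t) t"
      by (subst nderiv_sum) (auto intro: smooth_dop behaviour_smooth[OF w])
    also have "\<dots> = 0"
      by (simp add: behaviour_eq[OF w i] nderiv_zero)
    finally show ?thesis .
  qed
  then have "pdo R (dvec 1 w) t = 0\<^sub>v (dim_row R)" for t
    by (intro eq_vecI) auto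
  moreover have "smooth_fun (\<lambda>t. dvec 1 w t $ j)" if "j < dim_col R" for j
    unfolding nth[OF that] by (intro smooth_nderiv behaviour_smooth[OF w] that)
  moreover have "dim_vec (dvec 1 w t) = dim_col R" for t
    by (simp add: dvec_def dim)
  ultimately show ?thesis
    by (simp add: behaviour_def)
qed

text \<open>Stability speaks only of the trajectories themselves; since the derivative of a
  trajectory is again a trajectory, the decay passes to all orders, and thereby to the
  state.\<close>

lemma nderiv_tends_to_zero:
  assumes "beh_asympt_stable R" "w \<in> behaviour R" "j < dim_col R"
  shows "(nderiv k (\<lambda>s. w s $ j) \<longlongrightarrow> 0) at_top"
  using assms(2)
proof (induction k arbitrary: w)
  case 0
  then show ?case
    using assms(1,3) by (simp add: beh_asympt_stable_def tends_to_zero_def)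
next
  case (Suc k)
  have "(\<lambda>s. dvec 1 w s $ j) = nderiv 1 (\<lambda>s. w s $ j)"
    using Suc.prems assms(3) by (auto simp: dvec_def behaviour_def)
  then show ?case
    using Suc.IH[OF dvec_Suc_behaviour[OF Suc.prems]] by (simp add: nderiv_nderiv)
qed

lemma pdo_tends_to_zero:
  assumes "beh_asympt_stable R" "w \<in> behaviour R" "dim_col P = dim_col R" "i < dim_row P"
  shows "((\<lambda>t. pdo P w t $ i) \<longlongrightarrow> 0) at_top"
  unfolding pdo_index[OF assms(4)] dop_def
  by (intro tendsto_null_sum tendsto_mult_right_zero nderiv_tends_to_zero[OF assms(1,2)])
     (simp add: assms(3))

subsection \<open>State maps and reduction modulo \<open>R\<close>\<close>

lemma mat_mult_index_sum:
  assumes "A \<in> carrier_mat p m" "B \<in> carrier_mat m q" "i < p" "j < q"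
  shows "(A * B) $$ (i, j) = (\<Sum>a<m. A $$ (i, a) * B $$ (a, j))"
  using assms by (auto simp: scalar_prod_def atLeast0LessThan intro!: sum.cong)

lemma mat_vec_index_sum:
  assumes "A \<in> carrier_mat p m" "v \<in> carrier_vec m" "i < p"
  shows "(A *\<^sub>v v) $ i = (\<Sum>a<m. A $$ (i, a) * v $ a)"
  using assms by (auto simp: scalar_prod_def atLeast0LessThan intro!: sum.cong)

lemma degree_le_pmat_degree:
  assumes "i < dim_row P" "j < dim_col P"
  shows "degree (P $$ (i, j)) \<le> pmat_degree P"
proof -
  have "{degree (P $$ (i, j)) |i j. i < dim_row P \<and> j < dim_col P}
      = (\<lambda>(i, j). degree (P $$ (i, j))) ` ({..<dim_row P} \<times> {..<dim_col P})"
    by auto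
  then have "finite {degree (P $$ (i, j)) |i j. i < dim_row P \<and> j < dim_col P}"
    by simp
  then show ?thesis
    unfolding pmat_degree_def using assms by (intro Max_ge) auto
qed

interpretation of_real_poly: map_poly_comm_ring_hom complex_of_real ..

locale state_map =
  fixes R X :: "real poly mat" and wd :: nat
  assumes R: "R \<in> carrier_mat wd wd"
    and det_nonzero: "det R \<noteq> 0"
    and minimal: "minimal_state_map X R"
begin

abbreviation n :: nat where "n \<equiv> degree (det R)"

lemma R_dims [simp]: "dim_row R = wd" "dim_col R = wd"
  using R by auto

lemma X: "X \<in> carrier_mat n wd"
proof -
  have "dim_row X = n \<and> dim_col X = dim_col R"
    using minimal unfolding minimal_state_map_def by blast
  then show ?thesis
    by (intro carrier_matI) auto
qed

lemma X_dims [simp]: "dim_row X = n" "dim_col X = wd"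
  using X by auto

text \<open>\<open>c\<close> holds the coordinates, with respect to the rows of \<open>X\<close>, of the class of the row \<open>f\<close> modulo
  the row module of \<open>R\<close>.\<close>

definition decomp :: "(nat \<Rightarrow> real poly) \<Rightarrow> (nat \<Rightarrow> real) \<Rightarrow> bool" where
  "decomp f c \<longleftrightarrow> (\<exists>q. \<forall>j<wd. f j = (\<Sum>i<n. Polynomial.smult (c i) (X $$ (i, j)))
                                    + (\<Sum>i<wd. q i * R $$ (i, j)))"

text \<open>Divide the row \<open>f adj R\<close> by \<open>det R\<close>. Subtracting the quotient
  times \<open>R\<close> from \<open>f\<close> leaves a row whose product with \<open>adj R\<close>
  is the remainder; that row is strictly proper, hence in the span of the rows of
  \<open>X\<close>.\<close>

lemma decomp_exists: "\<exists>c. decomp f c"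
proof -
  note adj = adj_mat[OF R]
  define fadj where "fadj j = (\<Sum>i<wd. f i * adj_mat R $$ (i, j))" for j
  \<comment> \<open>\<open>q\<close> is the polynomial part of \<open>f R^{-1}\<close>, and
    \<open>g\<close> below is \<open>f mod R\<close>.\<close>
  define q where "q j = fadj j div det R" for j
  define g where "g = vec wd (\<lambda>j. f j - (\<Sum>i<wd. q i * R $$ (i, j)))"
  have "(\<Sum>i<wd. g $ i * adj_mat R $$ (i, j)) = fadj j mod det R" if j: "j < wd" for j
  proof -
    have RA: "(\<Sum>i<wd. R $$ (a, i) * adj_mat R $$ (i, j)) = (if a = j then det R else 0)"
      if "a < wd" for a
      unfolding mat_mult_index_sum[OF R adj(1) that j, symmetric] adj(2) using that j by simp
    have "(\<Sum>i<wd. (\<Sum>a<wd. q a * R $$ (a, i)) * adj_mat R $$ (i, j))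
        = (\<Sum>a<wd. q a * (\<Sum>i<wd. R $$ (a, i) * adj_mat R $$ (i, j)))"
      unfolding sum_distrib_left sum_distrib_right
      by (subst sum.swap) (simp add: mult.assoc)
    also have "\<dots> = (\<Sum>a<wd. if a = j then q a * det R else 0)"
      by (intro sum.cong) (auto simp: RA)
    also have "\<dots> = q j * det R"
      using j by simp
    finally have "(\<Sum>i<wd. g $ i * adj_mat R $$ (i, j)) = fadj j - q j * det R"
      by (simp add: g_def fadj_def left_diff_distrib sum_subtractf)
    then show ?thesis
      by (simp add: q_def minus_div_mult_eq_mod)
  qed
  then have "g \<in> state_space R"
    using degree_mod_less[OF det_nonzero] unfolding state_space_def strictly_proper_row_def
    by (auto simp: Let_def g_def)
  then obtain c where "\<forall>j<wd. g $ j = (\<Sum>i<n. Polynomial.smult (c i) (X $$ (i, j)))"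
    using minimal unfolding minimal_state_map_def X_dims by blast
  then have "\<forall>j<wd. f j = (\<Sum>i<n. Polynomial.smult (c i) (X $$ (i, j))) + (\<Sum>i<wd. q i * R $$ (i, j))"
    by (simp add: g_def algebra_simps)
  then show ?thesis
    unfolding decomp_def by blast
qed

text \<open>By definition \<open>G mod R\<close> is \<open>G - P * R\<close> with \<open>P\<close>
  polynomial, so the rows of \<open>P\<close> are the required multipliers and those of
  \<open>F\<close> the coordinates.\<close>

lemma decomp_pmat_mod:
  assumes G: "dim_col G = wd" and F: "F \<in> carrier_mat (dim_row G) n"
    and eq: "pmat_mod G R = const_pmat F * X" and i: "i < dim_row G"
  shows "decomp (\<lambda>j. G $$ (i, j)) (\<lambda>a. F $$ (i, a))"
proof -
  define P where "P = map_mat (\<lambda>q. q div det R) (G * adj_mat R)"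
  have P: "P \<in> carrier_mat (dim_row G) wd"
    unfolding P_def using adj_mat(1)[OF R] by (intro map_carrier_mat[THEN iffD2] mult_carrier_mat[of _ _ wd]) (auto simp: G)
  have cF: "const_pmat F \<in> carrier_mat (dim_row G) n"
    using F by (simp add: const_pmat_def)
  have "G $$ (i, j) = (\<Sum>a<n. Polynomial.smult (F $$ (i, a)) (X $$ (a, j))) + (\<Sum>a<wd. P $$ (i, a) * R $$ (a, j))"
    if j: "j < wd" for j
  proof -
    have "(const_pmat F * X) $$ (i, j) = (\<Sum>a<n. Polynomial.smult (F $$ (i, a)) (X $$ (a, j)))"
      unfolding mat_mult_index_sum[OF cF X i j] using F i by (simp add: const_pmat_def)
    moreover have "(G - P * R) $$ (i, j) = G $$ (i, j) - (\<Sum>a<wd. P $$ (i, a) * R $$ (a, j))"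
      unfolding mat_mult_index_sum[OF P R i j, symmetric] using P i j by (intro index_minus_mat) auto
    moreover have "G - P * R = const_pmat F * X"
      using eq unfolding pmat_mod_def P_def .
    ultimately show ?thesis
      by (simp only: diff_eq_eq)
  qed
  then show ?thesis
    unfolding decomp_def by (intro exI[of _ "\<lambda>a. P $$ (i, a)"]) simp
qed

text \<open>Multiples of the rows of \<open>R\<close> annihilate \<open>w\<close>, so only the part
  in the span of \<open>X\<close> survives: \<open>f(d/dt) w\<close> is a constant linear function
  of the state.\<close>

lemma decomp_behaviour:
  assumes f: "decomp f c" and w: "w \<in> behaviour R"
  shows "(\<Sum>j<wd. dop (f j) (\<lambda>s. w s $ j) t) = (\<Sum>i<n. c i * pdo X w t $ i)"
proof -
  obtain q where q: "\<And>j. j < wd \<Longrightarrow> f j = (\<Sum>i<n. Polynomial.smult (c i) (X $$ (i, j)))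
                                    + (\<Sum>i<wd. q i * R $$ (i, j))"
    using f by (auto simp: decomp_def)
  have sm: "smooth_fun (\<lambda>s. w s $ j)" if "j < wd" for j
    using behaviour_smooth[OF w] that by simp
  have "(\<Sum>j<wd. \<Sum>i<wd. dop (q i * R $$ (i, j)) (\<lambda>s. w s $ j) t)
      = (\<Sum>i<wd. \<Sum>j<wd. dop (q i) (dop (R $$ (i, j)) (\<lambda>s. w s $ j)) t)"
    by (subst sum.swap) (simp add: dop_mult sm)
  also have "\<dots> = (\<Sum>i<wd. dop (q i) (\<lambda>t. \<Sum>j<wd. dop (R $$ (i, j)) (\<lambda>s. w s $ j) t) t)"
    by (intro sum.cong refl, subst dop_sum_fun) (auto intro: smooth_dop sm)
  also have "\<dots> = 0"
    using behaviour_eq[OF w] by simp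
  finally have "(\<Sum>j<wd. dop (f j) (\<lambda>s. w s $ j) t)
      = (\<Sum>j<wd. \<Sum>i<n. c i * dop (X $$ (i, j)) (\<lambda>s. w s $ j) t)"
    by (simp add: q dop_add dop_sum dop_smult sum.distrib)
  also have "\<dots> = (\<Sum>i<n. c i * pdo X w t $ i)"
    by (subst sum.swap) (simp add: pdo_index sum_distrib_left)
  finally show ?thesis .
qed

abbreviation cpoly :: "real poly \<Rightarrow> complex \<Rightarrow> complex" where
  "cpoly p z \<equiv> poly (map_poly complex_of_real p) z"

text \<open>The counterpart of \<open>decomp_behaviour\<close> for the exponential solution with
  exponent \<open>z\<close> and direction \<open>v\<close>, done algebraically by evaluating
  polynomials at \<open>z\<close>.\<close>

lemma decomp_eval:
  assumes f: "decomp f c" and v: "v \<in> carrier_vec wd" and ker: "peval_c R z *\<^sub>v v = 0\<^sub>v wd"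
  shows "(\<Sum>j<wd. cpoly (f j) z * v $ j)
       = (\<Sum>i<n. complex_of_real (c i) * (peval_c X z *\<^sub>v v) $ i)"
proof -
  obtain q where q: "\<And>j. j < wd \<Longrightarrow> f j = (\<Sum>i<n. Polynomial.smult (c i) (X $$ (i, j)))
                                    + (\<Sum>i<wd. q i * R $$ (i, j))"
    using f by (auto simp: decomp_def)
  have cR: "peval_c R z \<in> carrier_mat wd wd" and cX: "peval_c X z \<in> carrier_mat n wd"
    by (auto simp: peval_c_def)
  have Rv: "(\<Sum>j<wd. cpoly (R $$ (i, j)) z * v $ j) = 0" if "i < wd" for i
    using mat_vec_index_sum[OF cR v that] that unfolding ker by (simp add: peval_c_def)
  have Xv: "(peval_c X z *\<^sub>v v) $ i = (\<Sum>j<wd. cpoly (X $$ (i, j)) z * v $ j)" if "i < n" for i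
    using mat_vec_index_sum[OF cX v that] that by (simp add: peval_c_def)
  have fj: "cpoly (f j) z = (\<Sum>i<n. complex_of_real (c i) * cpoly (X $$ (i, j)) z)
                         + (\<Sum>i<wd. cpoly (q i) z * cpoly (R $$ (i, j)) z)" if "j < wd" for j
    using that by (simp add: q hom_distribs of_real_poly.hom_sum poly_sum)
  have "(\<Sum>j<wd. (\<Sum>i<wd. cpoly (q i) z * cpoly (R $$ (i, j)) z) * v $ j)
      = (\<Sum>i<wd. cpoly (q i) z * (\<Sum>j<wd. cpoly (R $$ (i, j)) z * v $ j))"
    unfolding sum_distrib_left sum_distrib_right by (subst sum.swap) (simp add: mult.assoc)
  also have "\<dots> = 0"
    by (simp add: Rv)
  finally have "(\<Sum>j<wd. cpoly (f j) z * v $ j)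
      = (\<Sum>j<wd. (\<Sum>i<n. complex_of_real (c i) * cpoly (X $$ (i, j)) z) * v $ j)"
    by (simp add: fj distrib_right sum.distrib)
  also have "\<dots> = (\<Sum>i<n. complex_of_real (c i) * (peval_c X z *\<^sub>v v) $ i)"
    unfolding sum_distrib_right by (subst sum.swap) (simp add: Xv sum_distrib_left mult.assoc)
  finally show ?thesis .
qed

text \<open>From \<open>X det R = (X adj R) R\<close>, where the entries of \<open>X adj R\<close>
  have degree below \<open>n\<close>: multiplying by \<open>R\<close> and cancelling
  \<open>det R\<close> leaves degree below that of \<open>R\<close>. Hence \<open>Xtil\<close>
  contains every coefficient of \<open>X\<close>.\<close>

lemma coeff_X_eq_0:
  assumes i: "i < n" and j: "j < wd" and k: "pmat_degree R \<le> k"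
  shows "coeff (X $$ (i, j)) k = 0"
proof (rule ccontr)
  assume nz: "coeff (X $$ (i, j)) k \<noteq> 0"
  then have kd: "k \<le> degree (X $$ (i, j))" and X0: "X $$ (i, j) \<noteq> 0"
    by (auto intro: le_degree)
  note adj = adj_mat[OF R]
  define q where "q b = (\<Sum>a<wd. X $$ (i, a) * adj_mat R $$ (a, b))" for b
  have "row X i \<in> state_space R"
    using minimal i unfolding minimal_state_map_def X_dims by blast
  then have q: "q b = 0 \<or> degree (q b) < n" if "b < wd" for b
    using that i by (auto simp: state_space_def strictly_proper_row_def Let_def q_def)
  have "(\<Sum>b<wd. q b * R $$ (b, j)) = (\<Sum>a<wd. X $$ (i, a) * (\<Sum>b<wd. adj_mat R $$ (a, b) * R $$ (b, j)))"
    unfolding q_def sum_distrib_left sum_distrib_right by (subst sum.swap) (simp add: mult.assoc)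
  also have "\<dots> = (\<Sum>a<wd. if a = j then X $$ (i, a) * det R else 0)"
  proof (intro sum.cong refl)
    fix a assume "a \<in> {..<wd}"
    then have a: "a < wd" by simp
    show "X $$ (i, a) * (\<Sum>b<wd. adj_mat R $$ (a, b) * R $$ (b, j))
        = (if a = j then X $$ (i, a) * det R else 0)"
      unfolding mat_mult_index_sum[OF adj(1) R a j, symmetric] adj(3) using a j by simp
  qed
  also have "\<dots> = X $$ (i, j) * det R"
    using j by simp
  finally have eq: "X $$ (i, j) * det R = (\<Sum>b<wd. q b * R $$ (b, j))"
    by simp
  have "degree (X $$ (i, j) * det R) = degree (X $$ (i, j)) + n"
    using X0 det_nonzero by (rule degree_mult_eq)
  then have d: "k + n \<le> degree (X $$ (i, j) * det R)"
    using kd by simp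
  \<comment> \<open>The product \<open>X det R\<close> has degree at least \<open>k + n\<close>,
    whereas each summand on the right has degree below \<open>n + pmat_degree R\<close>; so the
    leading coefficient would be zero.\<close>
  have "coeff (q b * R $$ (b, j)) (degree (X $$ (i, j) * det R)) = 0" if b: "b < wd" for b
  proof (cases "q b = 0")
    case False
    then have "degree (q b * R $$ (b, j)) < n + pmat_degree R"
      using q[OF b] degree_mult_le[of "q b" "R $$ (b, j)"] degree_le_pmat_degree[of b R j] b j by auto
    then show ?thesis
      using d k by (intro coeff_eq_0) simp
  qed simp
  then have "lead_coeff (X $$ (i, j) * det R) = 0"
    by (subst (1) eq) (simp add: coeff_sum)
  then show False
    using X0 det_nonzero by simp
qed

text \<open>Along trajectories this reads \<open>x' = A x\<close>; at a root of \<open>det R\<close>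
  it makes \<open>X(\<lambda>) w\<close> an eigenvector of \<open>A\<close>.\<close>

lemma state_equation:
  "\<exists>A. \<forall>i. decomp (\<lambda>j. pCons 0 (X $$ (i, j))) (A i)"
  by (intro choice allI decomp_exists)

text \<open>Decomposing the unit rows recovers the trajectory from its state,
  \<open>w = C x\<close>.\<close>

lemma output_equation:
  "\<exists>C. \<forall>i. decomp (\<lambda>j. if j = i then 1 else 0) (C i)"
  by (intro choice allI decomp_exists)

end

subsection \<open>Factorisation of semidefinite forms\<close>

lemma scalar_prod_mat_mult:
  fixes K :: "real mat"
  assumes "M1 \<in> carrier_mat p m" "K \<in> carrier_mat p q" "M2 \<in> carrier_mat q m'"
    "x \<in> carrier_vec m" "y \<in> carrier_vec m'"
  shows "x \<bullet> ((transpose_mat M1 * K * M2) *\<^sub>v y) = (M1 *\<^sub>v x) \<bullet> (K *\<^sub>v (M2 *\<^sub>v y))"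
proof -
  let ?y = "K *\<^sub>v (M2 *\<^sub>v y)"
  have y: "?y \<in> carrier_vec p"
    using assms by auto
  have "(transpose_mat M1 * K * M2) *\<^sub>v y = transpose_mat M1 *\<^sub>v ?y"
    using assms by (simp add: assoc_mult_mat_vec[of _ m p _ m'] assoc_mult_mat_vec[of _ p q _ m'])
  then have "x \<bullet> ((transpose_mat M1 * K * M2) *\<^sub>v y) = (transpose_mat M1 *\<^sub>v ?y) \<bullet> x"
    using assms by (simp add: comm_scalar_prod[of x m])
  also have "\<dots> = ?y \<bullet> (M1 *\<^sub>v x)"
    using assms y by (intro transpose_vec_mult_scalar)
  also have "\<dots> = (M1 *\<^sub>v x) \<bullet> ?y"
    using assms y by (intro comm_scalar_prod[of _ p]) auto
  finally show ?thesis .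
qed

text \<open>Move from \<open>z\<close> in the direction \<open>y = M z\<close>: the form becomes
  \<open>s * (2 * p + s * c)\<close> with \<open>p\<close> the squared norm of \<open>y\<close>,
  which is positive for small positive \<open>s\<close> unless \<open>p = 0\<close>.\<close>

lemma neg_semidef_isotropic:
  assumes M: "neg_semidef M" "M \<in> carrier_mat m m" and z: "z \<in> carrier_vec m" "z \<bullet> (M *\<^sub>v z) = 0"
  shows "M *\<^sub>v z = 0\<^sub>v m"
proof -
  define y where "y = M *\<^sub>v z"
  define p where "p = y \<bullet> y"
  define c where "c = y \<bullet> (M *\<^sub>v y)"
  have y: "y \<in> carrier_vec m" and My: "M *\<^sub>v y \<in> carrier_vec m"
    using M z by (auto simp: y_def)
  have tr: "transpose_mat M = M" and neg: "\<And>x. x \<in> carrier_vec m \<Longrightarrow> x \<bullet> (M *\<^sub>v x) \<le> 0"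
    using M by (auto simp: neg_semidef_def)
  have "z \<bullet> (M *\<^sub>v y) = p"
    using transpose_vec_mult_scalar[OF M(2) y z(1)] by (simp add: tr p_def y_def)
  then have form: "(z + s \<cdot>\<^sub>v y) \<bullet> (M *\<^sub>v (z + s \<cdot>\<^sub>v y)) = s * (2 * p + s * c)" for s
    using M z y My
    by (simp add: mult_add_distrib_mat_vec[of _ m m] mult_mat_vec[of _ m m]
        add_scalar_prod_distrib[of _ m] scalar_prod_add_distrib[of _ m] y_def[symmetric] p_def[symmetric]
        c_def[symmetric] algebra_simps)
  have p: "p = 0"
  proof (rule ccontr)
    assume "p \<noteq> 0"
    moreover have "p \<ge> 0"
      unfolding p_def scalar_prod_def by (intro sum_nonneg) simp
    ultimately have p: "p > 0" by simp
    have c: "c \<le> 0"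
      using neg[OF y] by (simp add: c_def)
    \<comment> \<open>Since \<open>c \<le> 0\<close> the denominator is at least 1, and this choice
      gives \<open>2 * p + s * c = p + s\<close>.\<close>
    define s where "s = p / (1 - c)"
    have s: "s > 0" and sc: "s * (1 - c) = p"
      using p c by (auto simp: s_def)
    have "2 * p + s * c = p + s"
      using sc by (simp add: algebra_simps)
    then have "s * (2 * p + s * c) > 0"
      using s p by simp
    moreover have "s * (2 * p + s * c) \<le> 0"
      unfolding form[symmetric] using z y by (intro neg) auto
    ultimately show False by simp
  qed
  then have "y $ i = 0" if "i < m" for i
  proof -
    have "(\<Sum>i = 0..<m. y $ i * y $ i) = 0"
      using p y by (simp add: p_def scalar_prod_def)
    then show ?thesis
      using that by (subst (asm) sum_nonneg_eq_0_iff) auto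
  qed
  then show ?thesis
    using y by (intro eq_vecI) (auto simp: y_def[symmetric])
qed

text \<open>The Gram matrix \<open>A A^T\<close> is invertible, because a kernel vector
  \<open>v\<close> makes the squared norm of \<open>A^T v\<close> zero; then
  \<open>A^T (A A^T)^{-1}\<close> is a right inverse.\<close>

lemma right_inverse_exists:
  fixes A :: "real mat"
  assumes A: "A \<in> carrier_mat n m"
    and inj: "\<And>y. y \<in> carrier_vec n \<Longrightarrow> transpose_mat A *\<^sub>v y = 0\<^sub>v m \<Longrightarrow> y = 0\<^sub>v n"
  obtains P where "P \<in> carrier_mat m n" "A * P = 1\<^sub>m n"
proof -
  let ?G = "A * transpose_mat A"
  have G: "?G \<in> carrier_mat n n"
    using A by auto
  have "det ?G \<noteq> 0"
  proof
    assume "det ?G = 0"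
    then obtain v where v: "v \<in> carrier_vec n" "v \<noteq> 0\<^sub>v n" "?G *\<^sub>v v = 0\<^sub>v n"
      using det_0_iff_vec_prod_zero[OF G] by auto
    define u where "u = transpose_mat A *\<^sub>v v"
    have u: "u \<in> carrier_vec m"
      using A v by (auto simp: u_def)
    have "u \<bullet> u = v \<bullet> (A *\<^sub>v u)"
      unfolding u_def by (rule transpose_vec_mult_scalar[OF A]) (use A v in auto)
    also have "A *\<^sub>v u = 0\<^sub>v n"
      unfolding u_def v(3)[symmetric] using A v by (intro assoc_mult_mat_vec[symmetric]) auto
    finally have "(\<Sum>i = 0..<m. u $ i * u $ i) = 0"
      using v u by (simp add: scalar_prod_def)
    then have "u $ i = 0" if "i < m" for i
      using that by (subst (asm) sum_nonneg_eq_0_iff) auto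
    then have "u = 0\<^sub>v m"
      using u by (intro eq_vecI) auto
    then show False
      using inj[OF v(1)] v(2) by (simp add: u_def)
  qed
  from det_non_zero_imp_unit[OF G this, of "()"]
  obtain B where B: "B \<in> carrier_mat n n" "?G * B = 1\<^sub>m n"
    by (auto simp: Units_def ring_mat_def)
  show thesis
  proof
    show "transpose_mat A * B \<in> carrier_mat m n"
      using A B by auto
    show "A * (transpose_mat A * B) = 1\<^sub>m n"
      using A B by (subst assoc_mult_mat[symmetric, of _ n m _ n _ n]) auto
  qed
qed

text \<open>With \<open>P\<close> a right inverse of \<open>A\<close>, the matrix
  \<open>E = P A\<close> is a projection along the kernel of \<open>A\<close>, on which
  \<open>M\<close> vanishes. So \<open>M = M E\<close>, by symmetry \<open>M = E^T M E\<close>, and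
  \<open>F = P^T M P\<close>.\<close>

lemma symmetric_factor_through:
  fixes M :: "real mat"
  assumes A: "A \<in> carrier_mat n m" and M: "M \<in> carrier_mat m m" "transpose_mat M = M"
    and inj: "\<And>y. y \<in> carrier_vec n \<Longrightarrow> transpose_mat A *\<^sub>v y = 0\<^sub>v m \<Longrightarrow> y = 0\<^sub>v n"
    and ker: "\<And>z. z \<in> carrier_vec m \<Longrightarrow> A *\<^sub>v z = 0\<^sub>v n \<Longrightarrow> M *\<^sub>v z = 0\<^sub>v m"
  shows "\<exists>F \<in> carrier_mat n n. M = transpose_mat A * F * A"
proof -
  obtain P where P: "P \<in> carrier_mat m n" "A * P = 1\<^sub>m n"
    using right_inverse_exists[OF A inj] by blast
  let ?E = "P * A"
  have E: "?E \<in> carrier_mat m m"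
    using P A by auto
  have ME: "M * ?E = M"
  proof (rule eq_matI)
    show "dim_row (M * ?E) = dim_row M" "dim_col (M * ?E) = dim_col M"
      using M A by auto
    fix i j assume ij: "i < dim_row M" "j < dim_col M"
    then have i: "i < m" and j: "j < m"
      using M by auto
    let ?e = "unit_vec m j :: real vec"
    have e: "?e \<in> carrier_vec m" by simp
    \<comment> \<open>The component of a unit vector in the kernel of \<open>A\<close>; applying
      \<open>M\<close> to it compares the columns of \<open>M\<close> and
      \<open>M E\<close>.\<close>
    define z where "z = ?e - ?E *\<^sub>v ?e"
    have z: "z \<in> carrier_vec m"
      using E unfolding z_def by auto
    have "A *\<^sub>v (?E *\<^sub>v ?e) = (A * P) *\<^sub>v (A *\<^sub>v ?e)"
      using A P(1) e by (simp add: assoc_mult_mat_vec[of _ m n _ m] assoc_mult_mat_vec[of _ n m _ n])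
    also have "\<dots> = A *\<^sub>v ?e"
      using A by (simp add: P(2))
    finally have "A *\<^sub>v z = 0\<^sub>v n"
      unfolding z_def using A E e
      by (subst mult_minus_distrib_mat_vec[of _ n m]) auto
    then have "M *\<^sub>v z = 0\<^sub>v m"
      by (rule ker[OF z])
    then have "M *\<^sub>v ?e - M *\<^sub>v (?E *\<^sub>v ?e) = 0\<^sub>v m"
      unfolding z_def using M(1) E e by (subst (asm) mult_minus_distrib_mat_vec[of _ m m]) auto
    moreover have "M *\<^sub>v (?E *\<^sub>v ?e) = (M * ?E) *\<^sub>v ?e"
      using M(1) E e by (intro assoc_mult_mat_vec[symmetric])
    ultimately have "M *\<^sub>v ?e - (M * ?E) *\<^sub>v ?e = 0\<^sub>v m"
      by simp
    then have "(M *\<^sub>v ?e - (M * ?E) *\<^sub>v ?e) $ i = 0"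
      using i by simp
    moreover have "(N *\<^sub>v ?e) $ i = N $$ (i, j)" if "N \<in> carrier_mat m m" for N :: "real mat"
      unfolding mat_vec_index_sum[OF that e i] using j
      by (simp add: unit_vec_def if_distrib cong: if_cong)
    note this[OF M(1)] this[OF mult_carrier_mat[OF M(1) E]]
    moreover have "(M *\<^sub>v ?e - (M * ?E) *\<^sub>v ?e) $ i = (M *\<^sub>v ?e) $ i - ((M * ?E) *\<^sub>v ?e) $ i"
      using M(1) E i by (intro index_minus_vec) auto
    ultimately show "(M * ?E) $$ (i, j) = M $$ (i, j)"
      by simp
  qed
  have "M = transpose_mat ?E * M"
    using arg_cong[OF ME, of transpose_mat] M E by (simp add: transpose_mult[of _ m m _ m])
  also have "\<dots> = transpose_mat ?E * (M * ?E)"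
    by (simp only: ME)
  also have "\<dots> = transpose_mat A * (transpose_mat P * M * P) * A"
    using A P(1) M(1)
    by (simp add: transpose_mult[of _ m n _ m] assoc_mult_mat[of _ m n _ m _ m] assoc_mult_mat[of _ m n _ n _ m]
        assoc_mult_mat[of _ n m _ m _ m] assoc_mult_mat[of _ n m _ m _ n] assoc_mult_mat[of _ n m _ n _ m] assoc_mult_mat[of _ m m _ n _ m]
        assoc_mult_mat[of _ n n _ n _ m])
  finally have "M = transpose_mat A * (transpose_mat P * M * P) * A" .
  moreover have "transpose_mat P * M * P \<in> carrier_mat n n"
    using P M by auto
  ultimately show ?thesis by blast
qed

subsection \<open>The matrix inequality along a behaviour\<close>

lemma mult_mat_zero_vec: "A \<in> carrier_mat p m \<Longrightarrow> A *\<^sub>v 0\<^sub>v m = 0\<^sub>v p"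
  by (intro eq_vecI) auto

text \<open>The derivatives are laid out in the column order of \<open>coeff_stack\<close>: position
  \<open>k * wd + j\<close> holds the \<open>k\<close>-th derivative of component
  \<open>j\<close>.\<close>

definition jet :: "nat \<Rightarrow> nat \<Rightarrow> traj \<Rightarrow> real \<Rightarrow> real vec" where
  "jet wd d w t = vec (d * wd) (\<lambda>b. nderiv (b div wd) (\<lambda>s. w s $ (b mod wd)) t)"

lemma sum_div_mod:
  fixes g :: "nat \<Rightarrow> nat \<Rightarrow> 'a::comm_monoid_add"
  shows "(\<Sum>b<d * m. g (b div m) (b mod m)) = (\<Sum>k<d. \<Sum>j<m. g k j)"
proof -
  have "(\<Sum>b = k * m..<k * m + m. g (b div m) (b mod m)) = (\<Sum>j<m. g k j)" for k
  proof -
    have "(\<Sum>b = 0 + k * m..<m + k * m. g (b div m) (b mod m))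
        = (\<Sum>j = 0..<m. g ((j + k * m) div m) ((j + k * m) mod m))"
      by (rule sum.shift_bounds_nat_ivl)
    also have "\<dots> = (\<Sum>j<m. g k j)"
      by (intro sum.cong) auto
    finally show ?thesis
      by (simp add: add.commute)
  qed
  then show ?thesis
    by (simp flip: sum.nat_group)
qed

lemma coeff_stack_jet:
  assumes P: "dim_col P = wd"
    and deg: "\<And>i j. i < dim_row P \<Longrightarrow> j < wd \<Longrightarrow> degree (P $$ (i, j)) < d"
  shows "coeff_stack P d *\<^sub>v jet wd d w t = pdo P w t"
proof (rule eq_vecI)
  show "dim_vec (coeff_stack P d *\<^sub>v jet wd d w t) = dim_vec (pdo P w t)"
    by (simp add: coeff_stack_def)
  fix i assume "i < dim_vec (pdo P w t)"
  then have i: "i < dim_row P" by simp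
  have C: "coeff_stack P d \<in> carrier_mat (dim_row P) (d * wd)" and j: "jet wd d w t \<in> carrier_vec (d * wd)"
    by (auto simp: coeff_stack_def jet_def P)
  have "(coeff_stack P d *\<^sub>v jet wd d w t) $ i
      = (\<Sum>b<d * wd. coeff (P $$ (i, b mod wd)) (b div wd) * nderiv (b div wd) (\<lambda>s. w s $ (b mod wd)) t)"
    unfolding mat_vec_index_sum[OF C j i] using i P by (simp add: coeff_stack_def jet_def)
  also have "\<dots> = (\<Sum>k<d. \<Sum>j<wd. coeff (P $$ (i, j)) k * nderiv k (\<lambda>s. w s $ j) t)"
    by (rule sum_div_mod)
  also have "\<dots> = (\<Sum>j<wd. dop (P $$ (i, j)) (\<lambda>s. w s $ j) t)"
    by (subst sum.swap) (simp add: dop_eq_sum[OF deg[OF i]])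
  finally show "(coeff_stack P d *\<^sub>v jet wd d w t) $ i = pdo P w t $ i"
    by (simp add: pdo_index[OF i] P)
qed

section \<open>Coefficient stacks of \<open>X\<close>, \<open>\<xi>X\<close> and \<open>R\<close>
  acting on jets\<close>

context state_map
begin

text \<open>The number of coefficient blocks of \<open>Rtil R\<close>, used as the common length of
  all stacks.\<close>

abbreviation "d \<equiv> Suc (pmat_degree R)"
abbreviation "\<xi>X \<equiv> map_mat (pCons 0) X"

lemma coeff_stack_carrier: "coeff_stack X d \<in> carrier_mat n (d * wd)"
  "coeff_stack \<xi>X d \<in> carrier_mat n (d * wd)" "coeff_stack R d \<in> carrier_mat wd (d * wd)"
  by (simp_all add: coeff_stack_def)

text \<open>The zero block is the coefficient of \<open>X\<close> at the degree of \<open>R\<close>,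
  which vanishes by \<open>coeff_X_eq_0\<close>.\<close>

lemma blk_X0_eq: "blk_X0 R X = coeff_stack X d"
proof (rule eq_matI)
  fix i b assume "i < dim_row (coeff_stack X d)" "b < dim_col (coeff_stack X d)"
  then have i: "i < n" and b: "b < wd + pmat_degree R * wd"
    by (auto simp: coeff_stack_def)
  then have "0 < wd" by (cases wd) auto
  then have mod: "b mod wd < wd" by simp
  have "coeff (X $$ (i, b mod wd)) (b div wd) = 0" if "\<not> b < pmat_degree R * wd"
    using that \<open>0 < wd\<close> by (intro coeff_X_eq_0 i mod) (simp add: less_eq_div_iff_mult_less_eq)
  then show "blk_X0 R X $$ (i, b) = coeff_stack X d $$ (i, b)"
    using i b by (simp add: blk_X0_def hcat_def Xtil_def coeff_stack_def)
qed (auto simp: blk_X0_def hcat_def Xtil_def coeff_stack_def)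

text \<open>Shifting the coefficients by one block is multiplication by the indeterminate.\<close>

lemma blk_0X_eq: "blk_0X R X = coeff_stack \<xi>X d"
proof (rule eq_matI)
  fix i b assume "i < dim_row (coeff_stack \<xi>X d)" "b < dim_col (coeff_stack \<xi>X d)"
  then have i: "i < n" and b: "b < wd + pmat_degree R * wd"
    by (auto simp: coeff_stack_def)
  then have wd: "0 < wd" by (cases wd) auto
  show "blk_0X R X $$ (i, b) = coeff_stack \<xi>X d $$ (i, b)"
  proof (cases "b < wd")
    case True
    then show ?thesis
      using i b by (simp add: blk_0X_def hcat_def Xtil_def coeff_stack_def)
  next
    case False
    then have "b div wd = Suc ((b - wd) div wd)" "b mod wd = (b - wd) mod wd"
      using wd by (auto simp: le_div_geq le_mod_geq)
    then show ?thesis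
      using i b wd False by (simp add: blk_0X_def hcat_def Xtil_def coeff_stack_def)
  qed
qed (auto simp: blk_0X_def hcat_def Xtil_def coeff_stack_def)

lemma blk_XT0_eq: "blk_XT0 R X = transpose_mat (coeff_stack X d)"
  unfolding blk_X0_eq[symmetric]
  by (rule eq_matI) (auto simp: blk_XT0_def blk_X0_def hcat_def append_rows_def Xtil_def coeff_stack_def)

lemma blk_0XT_eq: "blk_0XT R X = transpose_mat (coeff_stack \<xi>X d)"
  unfolding blk_0X_eq[symmetric]
  by (rule eq_matI) (auto simp: blk_0XT_def blk_0X_def hcat_def append_rows_def Xtil_def coeff_stack_def)

lemmas blk_eqs = blk_X0_eq blk_0X_eq blk_XT0_eq blk_0XT_eq

lemma Rtil_eq: "Rtil R = coeff_stack R d"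
  by (simp add: Rtil_def)

lemma degree_X: "i < n \<Longrightarrow> j < wd \<Longrightarrow> degree (X $$ (i, j)) < d"
  using coeff_X_eq_0 by (auto simp: less_Suc_eq_le intro!: degree_le)

lemma degree_\<xi>X: "i < n \<Longrightarrow> j < wd \<Longrightarrow> degree (pCons 0 (X $$ (i, j))) < d"
  unfolding less_Suc_eq_le by (rule degree_le) (auto simp: coeff_pCons coeff_X_eq_0 split: nat.splits)

lemma coeff_stack_X_jet: "coeff_stack X d *\<^sub>v jet wd d w t = pdo X w t"
  by (rule coeff_stack_jet) (auto simp: degree_X)

lemma coeff_stack_\<xi>X_jet: "coeff_stack \<xi>X d *\<^sub>v jet wd d w t = pdo \<xi>X w t"
  using degree_\<xi>X by (intro coeff_stack_jet) (auto simp del: degree_pCons_eq_if)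

lemma coeff_stack_R_jet: "coeff_stack R d *\<^sub>v jet wd d w t = pdo R w t"
  using degree_le_pmat_degree[of _ R] by (intro coeff_stack_jet) (auto simp: less_Suc_eq_le)

text \<open>A relation among the coefficient rows is a relation among the polynomial rows of
  \<open>X\<close>, read coefficient by coefficient; a minimal state map admits only the trivial
  one.\<close>

lemma coeff_stack_X_rows_indep:
  assumes y: "y \<in> carrier_vec n" and 0: "transpose_mat (coeff_stack X d) *\<^sub>v y = 0\<^sub>v (d * wd)"
  shows "y = 0\<^sub>v n"
proof -
  have "(\<Sum>i<n. Polynomial.smult (y $ i) (X $$ (i, j))) = 0" if j: "j < wd" for j
  proof (rule poly_eqI)
    fix k
    show "coeff (\<Sum>i<n. Polynomial.smult (y $ i) (X $$ (i, j))) k = coeff 0 k"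
    proof (cases "k < d")
      case True
      \<comment> \<open>Column \<open>k * wd + j\<close> of the stack holds the coefficient of order
        \<open>k\<close> in column \<open>j\<close> of \<open>X\<close>.\<close>
      have "k * wd + j < k * wd + wd"
        using j by simp
      also have "\<dots> \<le> d * wd"
        using True mult_le_mono1[of "Suc k" d wd] by (simp add: add.commute)
      finally have b: "k * wd + j < d * wd" .
      have T: "transpose_mat (coeff_stack X d) \<in> carrier_mat (d * wd) n"
        using coeff_stack_carrier by auto
      have "(\<Sum>i<n. transpose_mat (coeff_stack X d) $$ (k * wd + j, i) * y $ i) = 0"
        unfolding mat_vec_index_sum[OF T y b, symmetric] 0 using b by simp
      then show ?thesis
        using b j by (simp add: coeff_sum coeff_stack_def mult.commute)
    next
      case False
      then show ?thesis
        using coeff_X_eq_0[OF _ j, of _ k] by (simp add: coeff_sum)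
    qed
  qed
  then have "\<forall>i<n. y $ i = 0"
    using minimal unfolding minimal_state_map_def X_dims by blast
  then show ?thesis
    using y by (intro eq_vecI) auto
qed

section \<open>The form of \<open>Phi_tilde\<close> and its factorisation\<close>

context
  fixes K Y :: "real mat"
  assumes K: "K \<in> carrier_mat n n" and Y: "Y \<in> carrier_mat wd n"
begin

lemma Phi_carrier: "Phi_tilde R X K Y \<in> carrier_mat (d * wd) (d * wd)"
  unfolding Phi_tilde_def blk_eqs Rtil_eq using coeff_stack_carrier K Y by auto

text \<open>Each of the four terms contains \<open>coeff_stack X d *\<^sub>v x\<close>, so the form
  vanishes on the kernel of that stack; the last two also contain
  \<open>coeff_stack R d *\<^sub>v x\<close>, so they vanish on jets of trajectories.\<close>

lemma Phi_form:
  assumes x: "x \<in> carrier_vec (d * wd)"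
  shows "x \<bullet> (Phi_tilde R X K Y *\<^sub>v x)
    = (coeff_stack \<xi>X d *\<^sub>v x) \<bullet> (K *\<^sub>v (coeff_stack X d *\<^sub>v x))
      + (coeff_stack X d *\<^sub>v x) \<bullet> (K *\<^sub>v (coeff_stack \<xi>X d *\<^sub>v x))
      - (coeff_stack X d *\<^sub>v x) \<bullet> (transpose_mat Y *\<^sub>v (coeff_stack R d *\<^sub>v x))
      - (coeff_stack R d *\<^sub>v x) \<bullet> (Y *\<^sub>v (coeff_stack X d *\<^sub>v x))"
proof -
  define m where "m = d * wd"
  note A = coeff_stack_carrier(1)[folded m_def]
  note B = coeff_stack_carrier(2)[folded m_def]
  note C = coeff_stack_carrier(3)[folded m_def]
  note x' = x[folded m_def]
  have YT: "transpose_mat Y \<in> carrier_mat n wd"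
    using Y by simp
  let ?A = "coeff_stack X d" and ?B = "coeff_stack \<xi>X d" and ?C = "coeff_stack R d"
  define T1 where "T1 = transpose_mat ?B * K * ?A"
  define T2 where "T2 = transpose_mat ?A * K * ?B"
  define T3 where "T3 = transpose_mat ?A * transpose_mat Y * ?C"
  define T4 where "T4 = transpose_mat ?C * Y * ?A"
  have T: "T1 \<in> carrier_mat m m" "T2 \<in> carrier_mat m m" "T3 \<in> carrier_mat m m" "T4 \<in> carrier_mat m m"
    unfolding T1_def T2_def T3_def T4_def using A B C K YT Y by (auto intro!: mult_carrier_mat)
  have add: "x \<bullet> ((T + U) *\<^sub>v x) = x \<bullet> (T *\<^sub>v x) + x \<bullet> (U *\<^sub>v x)"
    and diff: "x \<bullet> ((T - U) *\<^sub>v x) = x \<bullet> (T *\<^sub>v x) - x \<bullet> (U *\<^sub>v x)"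
    if "T \<in> carrier_mat m m" "U \<in> carrier_mat m m" for T U :: "real mat"
    using that x' by (auto simp: minus_mult_distrib_mat_vec[of _ m m] add_mult_distrib_mat_vec[of _ m m]
        scalar_prod_minus_distrib[of _ m] scalar_prod_add_distrib[of _ m])
  have "x \<bullet> ((T1 + T2 - T3 - T4) *\<^sub>v x)
      = x \<bullet> (T1 *\<^sub>v x) + x \<bullet> (T2 *\<^sub>v x) - x \<bullet> (T3 *\<^sub>v x) - x \<bullet> (T4 *\<^sub>v x)"
    using T by (simp add: add diff minus_carrier_mat)
  moreover have "Phi_tilde R X K Y = T1 + T2 - T3 - T4"
    unfolding Phi_tilde_def blk_eqs Rtil_eq T1_def T2_def T3_def T4_def ..
  ultimately show ?thesis
    unfolding T1_def T2_def T3_def T4_def scalar_prod_mat_mult[OF B K A x' x']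
      scalar_prod_mat_mult[OF A K B x' x'] scalar_prod_mat_mult[OF A YT C x' x'] scalar_prod_mat_mult[OF C Y A x' x']
    by simp
qed

lemma Phi_factor:
  assumes "neg_semidef (Phi_tilde R X K Y)"
  shows "\<exists>F\<in>carrier_mat n n. Phi_tilde R X K Y = blk_XT0 R X * F * blk_X0 R X"
  unfolding blk_eqs
proof (rule symmetric_factor_through[OF coeff_stack_carrier(1) Phi_carrier _ coeff_stack_X_rows_indep])
  show "transpose_mat (Phi_tilde R X K Y) = Phi_tilde R X K Y"
    using assms by (simp add: neg_semidef_def)
  fix z :: "real vec"
  assume z: "z \<in> carrier_vec (d * wd)" "coeff_stack X d *\<^sub>v z = 0\<^sub>v n"
  have "z \<bullet> (Phi_tilde R X K Y *\<^sub>v z) = 0"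
    unfolding Phi_form[OF z(1)] z(2) using K Y z(1) coeff_stack_carrier
    by (simp add: mult_mat_zero_vec)
  then show "Phi_tilde R X K Y *\<^sub>v z = 0\<^sub>v (d * wd)"
    by (rule neg_semidef_isotropic[OF assms Phi_carrier z(1)])
qed

text \<open>Evaluate \<open>Phi_tilde\<close> at the jet in two ways: through the factorisation, and
  through \<open>Phi_form\<close> with the \<open>R\<close> terms dropping out. As
  \<open>pdo \<xi>X w\<close> is the derivative of the state, the left side is the derivative of the
  Lyapunov function.\<close>

lemma Phi_along_behaviour:
  assumes F: "F \<in> carrier_mat n n" "Phi_tilde R X K Y = blk_XT0 R X * F * blk_X0 R X"
    and w: "w \<in> behaviour R"
  shows "pdo \<xi>X w t \<bullet> (K *\<^sub>v pdo X w t) + pdo X w t \<bullet> (K *\<^sub>v pdo \<xi>X w t)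
       = pdo X w t \<bullet> (F *\<^sub>v pdo X w t)"
proof -
  let ?v = "jet wd d w t"
  have v: "?v \<in> carrier_vec (d * wd)"
    by (simp add: jet_def)
  have R0: "pdo R w t = 0\<^sub>v wd"
    using w by (simp add: behaviour_def)
  have x: "pdo X w t \<in> carrier_vec n"
    by (intro carrier_vecI) simp
  have "?v \<bullet> (Phi_tilde R X K Y *\<^sub>v ?v) = pdo X w t \<bullet> (F *\<^sub>v pdo X w t)"
    unfolding F(2) blk_eqs scalar_prod_mat_mult[OF coeff_stack_carrier(1) F(1) coeff_stack_carrier(1) v v]
      coeff_stack_X_jet ..
  moreover have "?v \<bullet> (Phi_tilde R X K Y *\<^sub>v ?v)
      = pdo \<xi>X w t \<bullet> (K *\<^sub>v pdo X w t) + pdo X w t \<bullet> (K *\<^sub>v pdo \<xi>X w t)"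
    unfolding Phi_form[OF v] coeff_stack_X_jet coeff_stack_\<xi>X_jet coeff_stack_R_jet R0
    using x Y by (simp add: mult_mat_zero_vec)
  ultimately show ?thesis by simp
qed

end

end

subsection \<open>Invertibility of \<open>V\<close> and the re-initialisation inequality\<close>

lemma mat_adjoint_index:
  assumes "A \<in> carrier_mat p m" "i < m" "j < p"
  shows "mat_adjoint A $$ (i, j) = conjugate (A $$ (j, i))"
  using assms by (simp add: mat_adjoint_def mat_of_rows_index)

lemma mat_adjoint_carrier: "A \<in> carrier_mat p m \<Longrightarrow> mat_adjoint A \<in> carrier_mat m p"
  unfolding mat_adjoint_def by (auto simp: cols_length)

lemma conjugate_scalar_prod_adjoint:
  fixes V :: "complex mat"
  assumes V: "V \<in> carrier_mat p m" and z: "z \<in> carrier_vec m" and u: "u \<in> carrier_vec p"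
  shows "conjugate z \<bullet> (mat_adjoint V *\<^sub>v u) = conjugate (V *\<^sub>v z) \<bullet> u"
proof -
  have "conjugate z \<bullet> (mat_adjoint V *\<^sub>v u)
      = (\<Sum>i<m. cnj (z $ i) * (\<Sum>j<p. cnj (V $$ (j, i)) * u $ j))"
    using V z mat_vec_index_sum[OF mat_adjoint_carrier[OF V] u] mat_adjoint_carrier[OF V]
    by (auto simp: scalar_prod_def atLeast0LessThan mat_adjoint_index[OF V] conjugate_complex_def intro!: sum.cong)
  also have "\<dots> = (\<Sum>j<p. cnj (\<Sum>i<m. V $$ (j, i) * z $ i) * u $ j)"
    unfolding cnj_sum sum_distrib_left sum_distrib_right
    by (subst sum.swap) (simp add: ac_simps)
  also have "\<dots> = conjugate (V *\<^sub>v z) \<bullet> u"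
    using V z u mat_vec_index_sum[OF V z]
    by (auto simp: scalar_prod_def atLeast0LessThan conjugate_complex_def intro!: sum.cong)
  finally show ?thesis .
qed

abbreviation cvec :: "real vec \<Rightarrow> complex vec" where
  "cvec \<equiv> map_vec complex_of_real"

lemma cmat_mult_cvec:
  assumes "A \<in> carrier_mat p m" "x \<in> carrier_vec m"
  shows "cmat A *\<^sub>v cvec x = cvec (A *\<^sub>v x)"
  unfolding cmat_def by (rule of_real_hom.mult_mat_vec_hom[symmetric, OF assms])

lemma cvec_scalar_prod:
  assumes "x \<in> carrier_vec m" "y \<in> carrier_vec m"
  shows "conjugate (cvec x) \<bullet> cvec y = complex_of_real (x \<bullet> y)"
  using assms by (simp add: scalar_prod_def conjugate_complex_def)

text \<open>Test the hermitian inequality at the preimage \<open>z\<close> of \<open>x\<close> under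
  \<open>V\<close>. Both forms then become real forms in \<open>x\<close>, since \<open>V z\<close>
  is real even though \<open>z\<close> need not be.\<close>

lemma herm_geq_real_vec:
  assumes V: "V \<in> carrier_mat n n" and K: "K \<in> carrier_mat n n" and K': "K' \<in> carrier_mat m m"
    and L: "L \<in> carrier_mat m n" and x: "x \<in> carrier_vec n"
    and z: "z \<in> carrier_vec n" "V *\<^sub>v z = cvec x"
    and geq: "herm_geq (mat_adjoint V * cmat K * V)
                (mat_adjoint V * cmat (transpose_mat L) * cmat K' * cmat L * V)"
  shows "(L *\<^sub>v x) \<bullet> (K' *\<^sub>v (L *\<^sub>v x)) \<le> x \<bullet> (K *\<^sub>v x)"
proof -
  have V': "mat_adjoint V \<in> carrier_mat n n"
    using mat_adjoint_carrier[OF V] .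
  have c: "cmat K \<in> carrier_mat n n" "cmat K' \<in> carrier_mat m m" "cmat L \<in> carrier_mat m n"
    "cmat (transpose_mat L) \<in> carrier_mat n m"
    using K K' L by (auto simp: cmat_def)
  let ?A = "mat_adjoint V * cmat K * V"
  let ?B = "mat_adjoint V * cmat (transpose_mat L) * cmat K' * cmat L * V"
  let ?y = "L *\<^sub>v x"
  have y: "?y \<in> carrier_vec m" and Ky: "K' *\<^sub>v ?y \<in> carrier_vec m" and Kx: "K *\<^sub>v x \<in> carrier_vec n"
    using L x K K' by auto
  have LT: "transpose_mat L \<in> carrier_mat n m" and LKy: "transpose_mat L *\<^sub>v (K' *\<^sub>v ?y) \<in> carrier_vec n"
    using L Ky by auto
  have A: "?A \<in> carrier_mat n n" and B: "?B \<in> carrier_mat n n"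
    using V V' c by auto
  have "?A *\<^sub>v z = mat_adjoint V *\<^sub>v (cmat K *\<^sub>v (V *\<^sub>v z))"
    using V V' c z(1) by (simp add: assoc_mult_mat_vec[of _ n n _ n])
  also have "\<dots> = mat_adjoint V *\<^sub>v cvec (K *\<^sub>v x)"
    by (simp only: z(2) cmat_mult_cvec[OF K x])
  finally have "conjugate z \<bullet> (?A *\<^sub>v z) = conjugate (cvec x) \<bullet> cvec (K *\<^sub>v x)"
    using conjugate_scalar_prod_adjoint[OF V z(1), of "cvec (K *\<^sub>v x)"] Kx by (simp add: z(2))
  also have "\<dots> = complex_of_real (x \<bullet> (K *\<^sub>v x))"
    using x Kx by (intro cvec_scalar_prod)
  finally have 1: "conjugate z \<bullet> (?A *\<^sub>v z) = complex_of_real (x \<bullet> (K *\<^sub>v x))" .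
  have "?B *\<^sub>v z = mat_adjoint V *\<^sub>v (cmat (transpose_mat L) *\<^sub>v (cmat K' *\<^sub>v (cmat L *\<^sub>v (V *\<^sub>v z))))"
    using V V' c z(1) mult_carrier_mat[OF V' c(4)] mult_carrier_mat[OF mult_carrier_mat[OF V' c(4)] c(2)]
      mult_carrier_mat[OF mult_carrier_mat[OF mult_carrier_mat[OF V' c(4)] c(2)] c(3)]
    by (simp add: assoc_mult_mat_vec[of _ n n _ n] assoc_mult_mat_vec[of _ n m _ n]
        assoc_mult_mat_vec[of _ n m _ m] assoc_mult_mat_vec[of _ n n _ m] del: assoc_mult_mat)
  also have "\<dots> = mat_adjoint V *\<^sub>v cvec (transpose_mat L *\<^sub>v (K' *\<^sub>v ?y))"
    by (simp only: z(2) cmat_mult_cvec[OF L x] cmat_mult_cvec[OF K' y] cmat_mult_cvec[OF LT Ky])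
  finally have "conjugate z \<bullet> (?B *\<^sub>v z) = conjugate (cvec x) \<bullet> cvec (transpose_mat L *\<^sub>v (K' *\<^sub>v ?y))"
    using conjugate_scalar_prod_adjoint[OF V z(1), of "cvec (transpose_mat L *\<^sub>v (K' *\<^sub>v ?y))"] LKy by (simp add: z(2))
  also have "\<dots> = complex_of_real (x \<bullet> (transpose_mat L *\<^sub>v (K' *\<^sub>v ?y)))"
    using x LKy by (intro cvec_scalar_prod)
  also have "x \<bullet> (transpose_mat L *\<^sub>v (K' *\<^sub>v ?y)) = ?y \<bullet> (K' *\<^sub>v ?y)"
    using transpose_vec_mult_scalar[OF L x Ky] comm_scalar_prod[OF x LKy] comm_scalar_prod[OF y Ky] by simp
  finally have 2: "conjugate z \<bullet> (?B *\<^sub>v z) = complex_of_real (?y \<bullet> (K' *\<^sub>v ?y))" .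
  have "0 \<le> Re (conjugate z \<bullet> ((?A - ?B) *\<^sub>v z))"
    using geq z(1) A B unfolding herm_geq_def herm_psd_def by auto
  also have "conjugate z \<bullet> ((?A - ?B) *\<^sub>v z) = conjugate z \<bullet> (?A *\<^sub>v z) - conjugate z \<bullet> (?B *\<^sub>v z)"
    unfolding minus_mult_distrib_mat_vec[OF A B z(1)]
    using A B z(1) by (intro scalar_prod_minus_distrib[of _ n]) auto
  finally show ?thesis
    unfolding 1 2 by simp
qed

context state_map
begin

text \<open>With \<open>\<xi> X = A X\<close> modulo \<open>R\<close>, the columns \<open>X(\<lambda>\<^sub>i) w\<^sub>i\<close> are eigenvectors of \<open>A\<close> for \<open>\<lambda>\<^sub>i\<close>,
  so a linear relation among them splits into relations over equal \<open>\<lambda>\<^sub>i\<close>, and those are excluded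
  because \<open>w\<^sub>i\<close> is a fixed linear image of \<open>X(\<lambda>\<^sub>i) w\<^sub>i\<close>.\<close>

lemma Vmat_kernel:
  fixes lam :: "nat \<Rightarrow> complex" and wv :: "nat \<Rightarrow> complex vec"
  assumes wv: "\<And>i. i < n \<Longrightarrow> wv i \<in> carrier_vec wd \<and> peval_c R (lam i) *\<^sub>v wv i = 0\<^sub>v wd"
    and indep: "\<And>z c. (\<forall>a<wd. (\<Sum>i | i < n \<and> lam i = z. c i * wv i $ a) = 0) \<Longrightarrow>
        (\<forall>i. i < n \<and> lam i = z \<longrightarrow> c i = 0)"
    and z: "z \<in> carrier_vec n" "Vmat X lam wv *\<^sub>v z = 0\<^sub>v n"
  shows "z = 0\<^sub>v n"
proof -
  define v where "v i a = (peval_c X (lam i) *\<^sub>v wv i) $ a" for i a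
  obtain A where A: "\<And>a. decomp (\<lambda>j. pCons 0 (X $$ (a, j))) (A a)"
    using state_equation by blast
  obtain C where C: "\<And>a. decomp (\<lambda>j. if j = a then 1 else 0) (C a)"
    using output_equation by blast
  have v_sum: "v i a = (\<Sum>j<wd. cpoly (X $$ (a, j)) (lam i) * wv i $ j)" if "i < n" "a < n" for i a
  proof -
    have "peval_c X (lam i) \<in> carrier_mat n wd"
      using X by (simp add: peval_c_def)
    from mat_vec_index_sum[OF this _ that(2), of "wv i"] show ?thesis
      using wv[OF that(1)] that unfolding v_def by (simp add: peval_c_def)
  qed
  have eig: "lam i * v i a = (\<Sum>b<n. complex_of_real (A a b) * v i b)" if "i < n" "a < n" for i a
    using decomp_eval[OF A, of "wv i" "lam i" a] wv[OF that(1)]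
    by (simp add: v_sum[OF that] sum_distrib_left mult.assoc v_def[symmetric] of_real_hom.map_poly_pCons_hom)
  have out: "wv i $ a = (\<Sum>b<n. complex_of_real (C a b) * v i b)" if "i < n" "a < wd" for i a
  proof -
    have "(\<Sum>j<wd. cpoly (if j = a then 1 else 0) (lam i) * wv i $ j) = (\<Sum>j<wd. if j = a then wv i $ j else 0)"
      by (intro sum.cong) auto
    then show ?thesis
      using decomp_eval[OF C, of "wv i" "lam i" a] wv[OF that(1)] that(2)
      by (simp add: v_def[symmetric])
  qed
  have base: "(\<Sum>i<n. z $ i * v i a) = 0" if "a < n" for a
  proof -
    have "Vmat X lam wv \<in> carrier_mat n n"
      by (simp add: Vmat_def)
    from mat_vec_index_sum[OF this z(1) that] show ?thesis
      using that unfolding z(2) by (simp add: Vmat_def v_def mult.commute)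
  qed
  \<comment> \<open>Applying \<open>A - \<mu>\<close> to a relation among eigenvectors multiplies
    the \<open>i\<close>-th coefficient by \<open>lam i - \<mu>\<close>.\<close>
  have step: "(\<Sum>i<n. z $ i * (\<Prod>\<mu>\<in>S. lam i - \<mu>) * v i a) = 0" if "finite S" "a < n" for S a
    using that
  proof (induction S arbitrary: a rule: finite_induct)
    case empty
    then show ?case using base by simp
  next
    case (insert \<mu> S)
    let ?p = "\<lambda>i. z $ i * (\<Prod>\<mu>\<in>S. lam i - \<mu>)"
    have "(\<Sum>i<n. z $ i * (\<Prod>\<mu>\<in>insert \<mu> S. lam i - \<mu>) * v i a)
        = (\<Sum>i<n. ?p i * (lam i * v i a)) - \<mu> * (\<Sum>i<n. ?p i * v i a)"
      using insert.hyps by (simp add: sum_distrib_left sum_subtractf[symmetric] algebra_simps)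
    also have "(\<Sum>i<n. ?p i * (lam i * v i a)) = (\<Sum>i<n. ?p i * (\<Sum>b<n. complex_of_real (A a b) * v i b))"
      using insert.prems by (intro sum.cong) (auto simp: eig)
    also have "\<dots> = (\<Sum>b<n. complex_of_real (A a b) * (\<Sum>i<n. ?p i * v i b))"
      unfolding sum_distrib_left by (subst sum.swap) (simp add: ac_simps)
    also have "\<dots> - \<mu> * (\<Sum>i<n. ?p i * v i a) = 0"
      using insert.IH insert.prems by simp
    finally show ?case .
  qed
  have "z $ j = 0" if j: "j < n" for j
  proof -
    \<comment> \<open>Taking all eigenvalues other than \<open>lam j\<close> kills every term except
      those over \<open>lam j\<close>, which are scaled by the common nonzero factor
      \<open>c\<close>.\<close>
    let ?S = "lam ` {..<n} - {lam j}"
    let ?I = "{i. i < n \<and> lam i = lam j}"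
    define c where "c = (\<Prod>\<mu>\<in>?S. lam j - \<mu>)"
    have c: "c \<noteq> 0"
      unfolding c_def by (auto simp: prod_zero_iff)
    have v0: "(\<Sum>i\<in>?I. z $ i * v i a) = 0" if a: "a < n" for a
    proof -
      have "(\<Prod>\<mu>\<in>?S. lam i - \<mu>) = (if lam i = lam j then c else 0)" if "i < n" for i
        using that by (auto simp: c_def prod_zero_iff)
      then have "0 = (\<Sum>i<n. z $ i * (if lam i = lam j then c else 0) * v i a)"
        using step[of ?S, OF _ a] by simp
      also have "\<dots> = (\<Sum>i\<in>{..<n}. if lam i = lam j then c * (z $ i * v i a) else 0)"
        by (intro sum.cong) auto
      also have "\<dots> = (\<Sum>i\<in>{i \<in> {..<n}. lam i = lam j}. c * (z $ i * v i a))"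
        by (rule sum.inter_filter[symmetric]) simp
      also have "\<dots> = c * (\<Sum>i\<in>?I. z $ i * v i a)"
        by (simp add: sum_distrib_left)
      finally show ?thesis
        using c by simp
    qed
    \<comment> \<open>The output map \<open>C\<close> carries the relation from the states back to
      the vectors \<open>wv i\<close>, whose independence is assumed.\<close>
    have "(\<Sum>i\<in>?I. z $ i * wv i $ a) = 0" if a: "a < wd" for a
    proof -
      have "(\<Sum>i\<in>?I. z $ i * wv i $ a) = (\<Sum>i\<in>?I. z $ i * (\<Sum>b<n. complex_of_real (C a b) * v i b))"
        using a by (intro sum.cong) (auto simp: out)
      also have "\<dots> = (\<Sum>b<n. complex_of_real (C a b) * (\<Sum>i\<in>?I. z $ i * v i b))"
        unfolding sum_distrib_left by (subst sum.swap) (simp add: ac_simps)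
      finally show ?thesis
        by (simp add: v0)
    qed
    then have "\<forall>i. i < n \<and> lam i = lam j \<longrightarrow> z $ i = 0"
      by (intro indep) blast
    then show ?thesis
      using j by blast
  qed
  then show ?thesis
    using z(1) by (intro eq_vecI) auto
qed

lemma Vmat_surj:
  fixes lam :: "nat \<Rightarrow> complex" and wv :: "nat \<Rightarrow> complex vec"
  assumes wv: "\<And>i. i < n \<Longrightarrow> wv i \<in> carrier_vec wd \<and> peval_c R (lam i) *\<^sub>v wv i = 0\<^sub>v wd"
    and indep: "\<And>z c. (\<forall>a<wd. (\<Sum>i | i < n \<and> lam i = z. c i * wv i $ a) = 0) \<Longrightarrow>
        (\<forall>i. i < n \<and> lam i = z \<longrightarrow> c i = 0)"
    and x: "x \<in> carrier_vec n"
  obtains z where "z \<in> carrier_vec n" "Vmat X lam wv *\<^sub>v z = x"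
proof -
  let ?V = "Vmat X lam wv"
  have V: "?V \<in> carrier_mat n n"
    by (simp add: Vmat_def)
  have "det ?V \<noteq> 0"
    using det_0_iff_vec_prod_zero[OF V] Vmat_kernel[OF wv indep] by blast
  from det_non_zero_imp_unit[OF V this, of "()"]
  obtain B where B: "B \<in> carrier_mat n n" "?V * B = 1\<^sub>m n"
    by (auto simp: Units_def ring_mat_def)
  show thesis
  proof
    show "B *\<^sub>v x \<in> carrier_vec n"
      using B x by auto
    have "?V *\<^sub>v (B *\<^sub>v x) = (?V * B) *\<^sub>v x"
      using V B(1) x by (intro assoc_mult_mat_vec[symmetric])
    then show "?V *\<^sub>v (B *\<^sub>v x) = x"
      using B(2) x by simp
  qed
qed

end

subsection \<open>Uniform bounds on quadratic forms\<close>

lemma bilinear_form_sum: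
  fixes M :: "real mat"
  assumes "x \<in> carrier_vec p" "M \<in> carrier_mat p q" "y \<in> carrier_vec q"
  shows "x \<bullet> (M *\<^sub>v y) = (\<Sum>a<p. \<Sum>b<q. x $ a * M $$ (a, b) * y $ b)"
proof -
  have "x \<bullet> (M *\<^sub>v y) = (\<Sum>a<p. x $ a * (M *\<^sub>v y) $ a)"
    using assms by (auto simp: scalar_prod_def atLeast0LessThan)
  also have "\<dots> = (\<Sum>a<p. x $ a * (\<Sum>b<q. M $$ (a, b) * y $ b))"
    using mat_vec_index_sum[OF assms(2,3)] by (intro sum.cong) auto
  finally show ?thesis
    by (simp add: sum_distrib_left mult.assoc)
qed

text \<open>Bolzano-Weierstrass, one coordinate at a time: a further subsequence makes the next
  coordinate monotone, hence convergent, and keeps the earlier limits.\<close>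

lemma bounded_coordinates_convergent_subseq:
  fixes X :: "nat \<Rightarrow> nat \<Rightarrow> real"
  assumes "\<And>m i. i < n \<Longrightarrow> \<bar>X m i\<bar> \<le> B"
  shows "\<exists>r l. strict_mono (r :: nat \<Rightarrow> nat) \<and> (\<forall>i<n. (\<lambda>m. X (r m) i) \<longlonglongrightarrow> l i)"
  using assms
proof (induction n)
  case 0
  show ?case
    by (intro exI[of _ id]) (auto simp: strict_mono_def)
next
  case (Suc n)
  then obtain r l where r: "strict_mono r" "\<forall>i<n. (\<lambda>m. X (r m) i) \<longlonglongrightarrow> l i"
    by (meson less_SucI)
  obtain r' :: "nat \<Rightarrow> nat" where r': "strict_mono r'" "monoseq (\<lambda>m. X (r (r' m)) n)"
    using seq_monosub[of "\<lambda>m. X (r m) n"] by auto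
  have "Bseq (\<lambda>m. X (r (r' m)) n)"
    using Suc.prems by (intro BseqI'[of _ B]) auto
  then obtain L where L: "(\<lambda>m. X (r (r' m)) n) \<longlonglongrightarrow> L"
    using Bseq_monoseq_convergent[OF _ r'(2)] by (auto simp: convergent_def)
  have "(\<lambda>m. X (r (r' m)) i) \<longlonglongrightarrow> (l(n := L)) i" if "i < Suc n" for i
  proof (cases "i = n")
    case True
    then show ?thesis using L by simp
  next
    case False
    then show ?thesis
      using LIMSEQ_subseq_LIMSEQ[OF r(2)[rule_format, of i] r'(1)] that by (simp add: o_def)
  qed
  moreover have "strict_mono (\<lambda>m. r (r' m))"
    using strict_mono_o[OF r(1) r'(1)] by (simp add: o_def)
  ultimately show ?case
    by blast
qed

text \<open>Compactness of the unit sphere: if no \<open>e\<close> worked, unit vectors with form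
  values above \<open>-1/(m+1)\<close> would accumulate at a unit vector where the form is
  nonnegative.\<close>

lemma neg_def_uniform:
  assumes F: "F \<in> carrier_mat n n" "neg_def F"
  shows "\<exists>e>0. \<forall>x\<in>carrier_vec n. x \<bullet> (F *\<^sub>v x) \<le> - e * (x \<bullet> x)"
proof (rule ccontr)
  assume neg: "\<not> ?thesis"
  have "\<exists>x\<in>carrier_vec n. x \<bullet> x = 1 \<and> x \<bullet> (F *\<^sub>v x) > - inverse (real (Suc m))" for m
  proof -
    obtain y where y: "y \<in> carrier_vec n" "y \<bullet> (F *\<^sub>v y) > - inverse (real (Suc m)) * (y \<bullet> y)"
      using neg by (meson inverse_positive_iff_positive not_le of_nat_0_less_iff zero_less_Suc)
    have "y \<noteq> 0\<^sub>v n"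
      using y F(1) by (auto simp: mult_mat_zero_vec)
    then have "y \<bullet> (F *\<^sub>v y) < 0"
      using F y by (auto simp: neg_def_def)
    have pos: "y \<bullet> y > 0"
    proof -
      have "0 \<le> y \<bullet> y"
        unfolding scalar_prod_def by (intro sum_nonneg) simp
      moreover have "y \<bullet> y \<noteq> 0"
        using y \<open>y \<bullet> (F *\<^sub>v y) < 0\<close> by auto
      ultimately show ?thesis by simp
    qed
    \<comment> \<open>Both sides are homogeneous of degree two, so the violating vector can be
      scaled to length one.\<close>
    define s where "s = inverse (sqrt (y \<bullet> y))"
    have s: "s * (s * (y \<bullet> y)) = 1" "s > 0"
      using pos by (auto simp: s_def field_simps)
    have "- inverse (real (Suc m)) = s * (s * (- inverse (real (Suc m)) * (y \<bullet> y)))"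
      using s(1) by (simp add: ac_simps)
    also have "\<dots> < s * (s * (y \<bullet> (F *\<^sub>v y)))"
      using y(2) s(2) by (intro mult_strict_left_mono)
    also have "\<dots> = (s \<cdot>\<^sub>v y) \<bullet> (F *\<^sub>v (s \<cdot>\<^sub>v y))"
      using y(1) F(1) by (simp add: mult_mat_vec[of _ n n])
    finally have "(s \<cdot>\<^sub>v y) \<bullet> (F *\<^sub>v (s \<cdot>\<^sub>v y)) > - inverse (real (Suc m))" .
    moreover have "(s \<cdot>\<^sub>v y) \<bullet> (s \<cdot>\<^sub>v y) = 1"
      using s(1) y(1) by simp
    ultimately show ?thesis
      using y(1) by (intro bexI[of _ "s \<cdot>\<^sub>v y"] conjI) auto
  qed
  then obtain x where x: "\<And>m. x m \<in> carrier_vec n" "\<And>m. x m \<bullet> x m = 1"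
    "\<And>m. x m \<bullet> (F *\<^sub>v x m) > - inverse (real (Suc m))"
    by metis
  have sq: "(\<Sum>i<n. (x m $ i)\<^sup>2) = 1" for m
    using x(1,2)[of m] by (auto simp: scalar_prod_def power2_eq_square atLeast0LessThan)
  have "\<bar>x m $ i\<bar> \<le> 1" if "i < n" for m i
  proof -
    have "(x m $ i)\<^sup>2 \<le> (\<Sum>i<n. (x m $ i)\<^sup>2)"
      using that by (intro member_le_sum) auto
    then show ?thesis
      by (simp add: sq abs_square_le_1)
  qed
  then obtain r l where r: "strict_mono (r :: nat \<Rightarrow> nat)" "\<And>i. i < n \<Longrightarrow> (\<lambda>m. x (r m) $ i) \<longlonglongrightarrow> l i"
    using bounded_coordinates_convergent_subseq[of n "\<lambda>m i. x m $ i" 1] by blast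
  define y where "y = vec n l"
  have y: "y \<in> carrier_vec n" by (simp add: y_def)
  \<comment> \<open>The limit stays on the unit sphere, so it is nonzero and negative definiteness
    applies to it.\<close>
  have "(\<lambda>m. \<Sum>i<n. (x (r m) $ i)\<^sup>2) \<longlonglongrightarrow> (\<Sum>i<n. (l i)\<^sup>2)"
    using r(2) by (intro tendsto_sum tendsto_power) auto
  then have "(\<Sum>i<n. (l i)\<^sup>2) = 1"
    unfolding sq using LIMSEQ_unique tendsto_const by blast
  then have "\<exists>i<n. l i \<noteq> 0"
    by (metis (no_types, lifting) lessThan_iff power_zero_numeral sum.neutral zero_neq_one)
  then have "y \<noteq> 0\<^sub>v n"
    by (auto simp: y_def vec_eq_iff)
  then have lt: "y \<bullet> (F *\<^sub>v y) < 0"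
    using F y by (auto simp: neg_def_def)
  have "(\<lambda>m. \<Sum>a<n. \<Sum>b<n. x (r m) $ a * F $$ (a, b) * x (r m) $ b)
      \<longlonglongrightarrow> (\<Sum>a<n. \<Sum>b<n. l a * F $$ (a, b) * l b)"
    using r(2) by (intro tendsto_sum tendsto_mult tendsto_const) auto
  then have "(\<lambda>m. x (r m) \<bullet> (F *\<^sub>v x (r m))) \<longlonglongrightarrow> y \<bullet> (F *\<^sub>v y)"
    unfolding bilinear_form_sum[OF x(1) F(1) x(1)] bilinear_form_sum[OF y F(1) y] by (simp add: y_def)
  moreover have "(\<lambda>m. - inverse (real (Suc (r m)))) \<longlonglongrightarrow> - 0"
    using LIMSEQ_subseq_LIMSEQ[OF LIMSEQ_inverse_real_of_nat r(1)]
    by (intro tendsto_minus) (simp add: o_def)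
  ultimately have "- 0 \<le> y \<bullet> (F *\<^sub>v y)"
    using x(3) by (intro LIMSEQ_le[of _ "- 0"]) (auto intro: less_imp_le)
  with lt show False by simp
qed

text \<open>The sum of the absolute values of the entries serves as the constant, because each
  product of two coordinates is at most the sum of squares.\<close>

lemma quadratic_form_bound:
  fixes M :: "nat \<Rightarrow> nat \<Rightarrow> real"
  shows "\<exists>c\<ge>0. \<forall>x. \<bar>\<Sum>a<n. \<Sum>b<n. x a * M a b * x b\<bar> \<le> c * (\<Sum>a<n. (x a)\<^sup>2)"
proof (intro exI[of _ "\<Sum>a<n. \<Sum>b<n. \<bar>M a b\<bar>"] conjI allI)
  fix x :: "nat \<Rightarrow> real"
  let ?s = "\<Sum>a<n. (x a)\<^sup>2"
  have le: "(x a)\<^sup>2 \<le> ?s" if "a < n" for a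
    using that by (intro member_le_sum) auto
  have "\<bar>x a * M a b * x b\<bar> \<le> \<bar>M a b\<bar> * ?s" if "a < n" "b < n" for a b
  proof -
    have "2 * (\<bar>x a\<bar> * \<bar>x b\<bar>) \<le> (x a)\<^sup>2 + (x b)\<^sup>2"
      using sum_squares_bound[of "\<bar>x a\<bar>" "\<bar>x b\<bar>"] by simp
    then have "\<bar>x a\<bar> * \<bar>x b\<bar> \<le> ?s"
      using le[OF that(1)] le[OF that(2)] by simp
    then have "\<bar>M a b\<bar> * (\<bar>x a\<bar> * \<bar>x b\<bar>) \<le> \<bar>M a b\<bar> * ?s"
      by (rule mult_left_mono) simp
    then show ?thesis
      by (simp add: abs_mult ac_simps)
  qed
  then have "(\<Sum>a<n. \<Sum>b<n. \<bar>x a * M a b * x b\<bar>) \<le> (\<Sum>a<n. \<Sum>b<n. \<bar>M a b\<bar> * ?s)"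
    by (intro sum_mono) auto
  moreover have "\<bar>\<Sum>a<n. \<Sum>b<n. x a * M a b * x b\<bar> \<le> (\<Sum>a<n. \<Sum>b<n. \<bar>x a * M a b * x b\<bar>)"
    by (intro order_trans[OF sum_abs] sum_mono sum_abs)
  ultimately show "\<bar>\<Sum>a<n. \<Sum>b<n. x a * M a b * x b\<bar> \<le> (\<Sum>a<n. \<Sum>b<n. \<bar>M a b\<bar>) * ?s"
    by (simp add: sum_distrib_right)
qed (intro sum_nonneg, simp)

lemma nonincreasing_from_deriv:
  fixes f :: "real \<Rightarrow> real"
  assumes "\<And>t. (f has_real_derivative f' t) (at t)" "\<And>t. f' t \<le> 0" "a \<le> b"
  shows "f b \<le> f a"
  using assms by (intro DERIV_nonpos_imp_nonincreasing[OF assms(3)]) blast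

lemma nonneg_if_nonincreasing_to_0:
  fixes f :: "real \<Rightarrow> real"
  assumes "\<And>a b. a \<le> b \<Longrightarrow> f b \<le> f a" "(f \<longlongrightarrow> 0) at_top"
  shows "0 \<le> f t"
  using assms by (intro tendsto_upperbound[OF assms(2)] eventually_at_top_linorderI[of t]) auto

subsection \<open>Lyapunov estimates for a single mode\<close>

context state_map
begin

lemma pdo_X_has_derivative:
  assumes w: "w \<in> behaviour R" and a: "a < n"
  shows "((\<lambda>t. pdo X w t $ a) has_real_derivative pdo \<xi>X w t $ a) (at t)"
proof -
  have "((\<lambda>t. \<Sum>j<wd. dop (X $$ (a, j)) (\<lambda>s. w s $ j) t) has_real_derivative
      (\<Sum>j<wd. dop (pCons 0 (X $$ (a, j))) (\<lambda>s. w s $ j) t)) (at t)"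
    by (intro DERIV_sum dop_has_derivative behaviour_smooth[OF w]) simp
  then show ?thesis
    using a by (simp add: pdo_index)
qed

lemma pdo_X_carrier: "pdo X w t \<in> carrier_vec n" "pdo \<xi>X w t \<in> carrier_vec n"
  by (auto intro!: carrier_vecI)

text \<open>Taken with \<open>K\<close> it is the Lyapunov function of the mode, with
  \<open>F\<close> the derivative of that function.\<close>

definition storage :: "real mat \<Rightarrow> traj \<Rightarrow> real \<Rightarrow> real" where
  "storage K w t = pdo X w t \<bullet> (K *\<^sub>v pdo X w t)"

lemma storage_sum:
  assumes "K \<in> carrier_mat n n"
  shows "storage K w t = (\<Sum>a<n. \<Sum>b<n. pdo X w t $ a * K $$ (a, b) * pdo X w t $ b)"
  unfolding storage_def by (rule bilinear_form_sum[OF pdo_X_carrier(1) assms pdo_X_carrier(1)])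

lemma qdf_psi_X:
  assumes K: "K \<in> carrier_mat n n" and w: "w \<in> behaviour R"
  shows "qdf (psi_X X K) (pmat_degree X) w t = storage K w t"
proof -
  let ?D = "pmat_degree X"
  \<comment> \<open>The contribution of the derivatives of order \<open>h\<close> to state component
    \<open>a\<close>; summing over \<open>h\<close> gives the state, so the double sum over orders
    factors.\<close>
  define u where "u h a = (\<Sum>j<wd. coeff (X $$ (a, j)) h * nderiv h (\<lambda>s. w s $ j) t)" for h a
  have dw: "dvec h w t \<in> carrier_vec wd" for h
    using w by (auto simp: dvec_def behaviour_def)
  have C: "coeff_mat X h \<in> carrier_mat n wd" for h
    by (simp add: coeff_mat_def)
  have Cd: "coeff_mat X h *\<^sub>v dvec h w t \<in> carrier_vec n" for h
    by (rule mult_mat_vec_carrier[OF C dw])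
  have u: "(coeff_mat X h *\<^sub>v dvec h w t) $ a = u h a" if "a < n" for h a
    unfolding mat_vec_index_sum[OF C dw that] using that w
    by (simp add: coeff_mat_def dvec_def u_def behaviour_def)
  have summand: "dvec h w t \<bullet> (psi_X X K h k *\<^sub>v dvec k w t) = (\<Sum>a<n. \<Sum>b<n. u h a * K $$ (a, b) * u k b)" for h k
    unfolding psi_X_def scalar_prod_mat_mult[OF C K C dw dw] bilinear_form_sum[OF Cd K Cd]
    by (simp add: u)
  have x: "pdo X w t $ a = (\<Sum>h\<le>?D. u h a)" if "a < n" for a
  proof -
    have "pdo X w t $ a = (\<Sum>j<wd. \<Sum>h<Suc ?D. coeff (X $$ (a, j)) h * nderiv h (\<lambda>s. w s $ j) t)"
      unfolding pdo_index[of a X, unfolded X_dims, OF that] using that degree_le_pmat_degree[of a X]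
      by (intro sum.cong refl dop_eq_sum) (simp add: less_Suc_eq_le)
    then show ?thesis
      unfolding u_def by (subst sum.swap) (simp only: lessThan_Suc_atMost)
  qed
  have "qdf (psi_X X K) ?D w t = (\<Sum>h\<le>?D. \<Sum>k\<le>?D. \<Sum>a<n. \<Sum>b<n. u h a * K $$ (a, b) * u k b)"
    by (simp add: qdf_def summand)
  also have "\<dots> = (\<Sum>h\<le>?D. \<Sum>a<n. \<Sum>k\<le>?D. \<Sum>b<n. u h a * K $$ (a, b) * u k b)"
    by (intro sum.cong refl sum.swap)
  also have "\<dots> = (\<Sum>a<n. \<Sum>h\<le>?D. \<Sum>k\<le>?D. \<Sum>b<n. u h a * K $$ (a, b) * u k b)"
    by (rule sum.swap)
  also have "\<dots> = (\<Sum>a<n. \<Sum>h\<le>?D. \<Sum>b<n. \<Sum>k\<le>?D. u h a * K $$ (a, b) * u k b)"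
    by (intro sum.cong refl sum.swap)
  also have "\<dots> = (\<Sum>a<n. \<Sum>b<n. \<Sum>h\<le>?D. \<Sum>k\<le>?D. u h a * K $$ (a, b) * u k b)"
    by (intro sum.cong refl sum.swap)
  also have "\<dots> = (\<Sum>a<n. \<Sum>b<n. (\<Sum>h\<le>?D. u h a) * K $$ (a, b) * (\<Sum>k\<le>?D. u k b))"
    unfolding sum_distrib_left sum_distrib_right by (intro sum.cong refl sum.swap)
  also have "\<dots> = storage K w t"
    unfolding storage_sum[OF K] by (simp add: x)
  finally show ?thesis .
qed

lemma storage_has_derivative:
  assumes K: "K \<in> carrier_mat n n" and Y: "Y \<in> carrier_mat wd n" and F: "F \<in> carrier_mat n n"
    and Phi: "Phi_tilde R X K Y = blk_XT0 R X * F * blk_X0 R X" and w: "w \<in> behaviour R"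
  shows "(storage K w has_real_derivative storage F w t) (at t)"
proof -
  let ?x = "\<lambda>t a. pdo X w t $ a" and ?x' = "\<lambda>a. pdo \<xi>X w t $ a"
  have "((\<lambda>t. \<Sum>a<n. \<Sum>b<n. ?x t a * K $$ (a, b) * ?x t b) has_real_derivative
      (\<Sum>a<n. \<Sum>b<n. ?x' a * K $$ (a, b) * ?x t b + ?x t a * K $$ (a, b) * ?x' b)) (at t)"
    by (intro DERIV_sum) (auto intro!: derivative_eq_intros pdo_X_has_derivative[OF w])
  also have "(\<Sum>a<n. \<Sum>b<n. ?x' a * K $$ (a, b) * ?x t b + ?x t a * K $$ (a, b) * ?x' b)
      = pdo \<xi>X w t \<bullet> (K *\<^sub>v pdo X w t) + pdo X w t \<bullet> (K *\<^sub>v pdo \<xi>X w t)"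
    unfolding bilinear_form_sum[OF pdo_X_carrier(2) K pdo_X_carrier(1)]
      bilinear_form_sum[OF pdo_X_carrier(1) K pdo_X_carrier(2)] by (simp add: sum.distrib)
  also have "\<dots> = storage F w t"
    unfolding storage_def by (rule Phi_along_behaviour[OF K Y F Phi w])
  also have "(\<lambda>t. \<Sum>a<n. \<Sum>b<n. ?x t a * K $$ (a, b) * ?x t b) = storage K w"
    by (intro ext) (simp add: storage_sum[OF K])
  finally show ?thesis .
qed

definition energy :: "traj \<Rightarrow> real \<Rightarrow> real" where
  "energy w t = (\<Sum>a<n. (pdo X w t $ a)\<^sup>2)"

lemma energy_nonneg: "0 \<le> energy w t"
  unfolding energy_def by (intro sum_nonneg) simp

lemma storage_bound:
  assumes "K \<in> carrier_mat n n"
  shows "\<exists>c\<ge>0. \<forall>w t. \<bar>storage K w t\<bar> \<le> c * energy w t"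
proof -
  obtain c where c: "c \<ge> 0" "\<And>x. \<bar>\<Sum>a<n. \<Sum>b<n. x a * K $$ (a, b) * x b\<bar> \<le> c * (\<Sum>a<n. (x a)\<^sup>2)"
    using quadratic_form_bound[where n = n and M = "\<lambda>a b. K $$ (a, b)"] by blast
  then show ?thesis
    unfolding storage_sum[OF assms] energy_def by blast
qed

lemma storage_neg_def:
  assumes "F \<in> carrier_mat n n" "neg_def F"
  shows "\<exists>e>0. \<forall>w t. storage F w t \<le> - e * energy w t"
proof -
  obtain e where e: "e > 0" "\<And>x. x \<in> carrier_vec n \<Longrightarrow> x \<bullet> (F *\<^sub>v x) \<le> - e * (x \<bullet> x)"
    using neg_def_uniform[OF assms] by blast
  have "pdo X w t \<bullet> pdo X w t = energy w t" for w t
    by (simp add: scalar_prod_def energy_def power2_eq_square atLeast0LessThan)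
  then show ?thesis
    using e(1) e(2)[OF pdo_X_carrier(1)] unfolding storage_def by (intro exI[of _ e]) auto
qed

text \<open>By \<open>x' = A x\<close> the derivative is \<open>2 x^T A x\<close>, a quadratic form
  in the state.\<close>

lemma energy_has_derivative:
  "\<exists>c\<ge>0. \<forall>w\<in>behaviour R. \<forall>t. \<exists>e'. (energy w has_real_derivative e') (at t) \<and> \<bar>e'\<bar> \<le> c * energy w t"
proof -
  obtain A where A: "\<And>a. decomp (\<lambda>j. pCons 0 (X $$ (a, j))) (A a)"
    using state_equation by blast
  obtain c where c: "c \<ge> 0" "\<And>x. \<bar>\<Sum>a<n. \<Sum>b<n. x a * A a b * x b\<bar> \<le> c * (\<Sum>a<n. (x a)\<^sup>2)"
    using quadratic_form_bound[where n = n and M = A] by blast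
  have "\<exists>e'. (energy w has_real_derivative e') (at t) \<and> \<bar>e'\<bar> \<le> 2 * c * energy w t"
    if w: "w \<in> behaviour R" for w t
  proof (intro exI conjI)
    let ?x = "\<lambda>a. pdo X w t $ a"
    show "(energy w has_real_derivative (\<Sum>a<n. 2 * ?x a * pdo \<xi>X w t $ a)) (at t)"
      unfolding energy_def[abs_def]
      by (intro DERIV_sum) (auto intro!: derivative_eq_intros pdo_X_has_derivative[OF w])
    have "pdo \<xi>X w t $ a = (\<Sum>b<n. A a b * ?x b)" if "a < n" for a
      using decomp_behaviour[OF A w, of a t] that by (simp add: pdo_index)
    then have "(\<Sum>a<n. 2 * ?x a * pdo \<xi>X w t $ a) = 2 * (\<Sum>a<n. \<Sum>b<n. ?x a * A a b * ?x b)"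
      by (simp add: sum_distrib_left mult.assoc)
    then show "\<bar>\<Sum>a<n. 2 * ?x a * pdo \<xi>X w t $ a\<bar> \<le> 2 * c * energy w t"
      using c(2)[of ?x] by (simp add: energy_def abs_mult)
  qed
  moreover have "0 \<le> 2 * c"
    using c(1) by simp
  ultimately show ?thesis
    by blast
qed

text \<open>Each component is \<open>C_j x\<close>, and its square is the quadratic form with the
  rank-one matrix \<open>C_j^T C_j\<close>. Summing the constants makes the bound uniform in
  \<open>j\<close>.\<close>

lemma energy_dominates:
  "\<exists>B\<ge>0. \<forall>w\<in>behaviour R. \<forall>t. \<forall>j<wd. (w t $ j)\<^sup>2 \<le> B * energy w t"
proof -
  obtain C where C: "\<And>a. decomp (\<lambda>j. if j = a then 1 else 0) (C a)"
    using output_equation by blast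
  have "\<forall>j. \<exists>c\<ge>0. \<forall>x. \<bar>\<Sum>a<n. \<Sum>b<n. x a * (C j a * C j b) * x b\<bar> \<le> c * (\<Sum>a<n. (x a)\<^sup>2)"
    by (intro allI quadratic_form_bound)
  from choice[OF this] obtain c where c: "\<And>j. c j \<ge> 0"
    "\<And>j x. \<bar>\<Sum>a<n. \<Sum>b<n. x a * (C j a * C j b) * x b\<bar> \<le> c j * (\<Sum>a<n. (x a)\<^sup>2)"
    by blast
  define B where "B = (\<Sum>j<wd. c j)"
  have "(w t $ j)\<^sup>2 \<le> B * energy w t" if w: "w \<in> behaviour R" and j: "j < wd" for w t j
  proof -
    have "(\<Sum>i<wd. dop (if i = j then 1 else 0) (\<lambda>s. w s $ i) t) = (\<Sum>i<wd. if i = j then w t $ i else 0)"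
      by (intro sum.cong) auto
    then have "w t $ j = (\<Sum>b<n. C j b * pdo X w t $ b)"
      using decomp_behaviour[OF C w, of j t] j by simp
    then have "(w t $ j)\<^sup>2 = (\<Sum>a<n. \<Sum>b<n. pdo X w t $ a * (C j a * C j b) * pdo X w t $ b)"
      by (simp add: power2_eq_square sum_product ac_simps)
    also have "\<dots> \<le> c j * energy w t"
      unfolding energy_def using c(2)[of "\<lambda>a. pdo X w t $ a" j] by linarith
    also have "\<dots> \<le> B * energy w t"
      unfolding B_def using j c(1) by (intro mult_right_mono energy_nonneg member_le_sum[of j]) auto
    finally show ?thesis .
  qed
  moreover have "B \<ge> 0"
    unfolding B_def by (intro sum_nonneg c(1))
  ultimately show ?thesis by blast
qed

text \<open>Both \<open>storage K - \<delta> energy\<close> and \<open>exp (c t) storage K\<close> are nonincreasing along the mode;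
  the former tends to 0, hence is nonnegative.\<close>

lemma mode_lyapunov:
  assumes stable: "beh_asympt_stable R"
    and K: "K \<in> carrier_mat n n" and Y: "Y \<in> carrier_mat wd n" and F: "F \<in> carrier_mat n n"
    and Phi: "Phi_tilde R X K Y = blk_XT0 R X * F * blk_X0 R X" and neg: "neg_def F"
  shows "\<exists>c>0. \<exists>B\<ge>0. \<forall>w\<in>behaviour R.
    (\<forall>t. 0 \<le> storage K w t) \<and>
    (\<forall>a b. a \<le> b \<longrightarrow> exp (c * b) * storage K w b \<le> exp (c * a) * storage K w a) \<and>
    (\<forall>t. \<forall>j<wd. (w t $ j)\<^sup>2 \<le> B * storage K w t)"
proof -
  obtain e where e: "e > 0" "\<And>w t. storage F w t \<le> - e * energy w t"
    using storage_neg_def[OF F neg] by blast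
  obtain cE where cE: "cE \<ge> 0"
    "\<And>w t. w \<in> behaviour R \<Longrightarrow> \<exists>e'. (energy w has_real_derivative e') (at t) \<and> \<bar>e'\<bar> \<le> cE * energy w t"
    using energy_has_derivative by blast
  obtain cK where cK: "cK \<ge> 0" "\<And>w t. \<bar>storage K w t\<bar> \<le> cK * energy w t"
    using storage_bound[OF K] by blast
  obtain B where B: "B \<ge> 0" "\<And>w t j. w \<in> behaviour R \<Longrightarrow> j < wd \<Longrightarrow> (w t $ j)\<^sup>2 \<le> B * energy w t"
    using energy_dominates by blast
  \<comment> \<open>\<open>\<delta> * cE \<le> e\<close> lets the decay of the storage outweigh the
    change of \<open>\<delta>\<close> times the energy, and \<open>c * cK \<le> e\<close> lets it
    outweigh \<open>c\<close> times the storage. The added 1 keeps the denominators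
    positive.\<close>
  define \<delta> where "\<delta> = e / (cE + 1)"
  define c where "c = e / (cK + 1)"
  have \<delta>: "\<delta> > 0" "\<delta> * cE \<le> e" and c: "c > 0" "c * cK \<le> e"
    using e(1) cE(1) cK(1) by (auto simp: \<delta>_def c_def field_simps)
  note deriv = storage_has_derivative[OF K Y F Phi]
  have coercive: "\<delta> * energy w t \<le> storage K w t" if w: "w \<in> behaviour R" for w t
  proof -
    have "\<forall>t. \<exists>e'. (energy w has_real_derivative e') (at t) \<and> \<bar>e'\<bar> \<le> cE * energy w t"
      using cE(2)[OF w] by blast
    from choice[OF this] obtain E'
      where E': "\<And>t. (energy w has_real_derivative E' t) (at t)" "\<And>t. \<bar>E' t\<bar> \<le> cE * energy w t"
      by blast
    have x0: "((\<lambda>t. pdo X w t $ a) \<longlongrightarrow> 0) at_top" if "a < n" for a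
      using pdo_tends_to_zero[OF stable w, of X a] that by simp
    have E0: "(energy w \<longlongrightarrow> 0) at_top"
      unfolding energy_def[abs_def] by (intro tendsto_null_sum) (auto intro!: tendsto_eq_intros x0)
    have S0: "(storage K w \<longlongrightarrow> 0) at_top"
      unfolding storage_sum[OF K, abs_def]
      by (intro tendsto_null_sum) (auto intro!: tendsto_eq_intros x0)
    have "0 \<le> storage K w t - \<delta> * energy w t"
    proof (rule nonneg_if_nonincreasing_to_0[where f = "\<lambda>t. storage K w t - \<delta> * energy w t" and t = t])
      show "((\<lambda>t. storage K w t - \<delta> * energy w t) \<longlongrightarrow> 0) at_top"
        using tendsto_diff[OF S0 tendsto_mult_right_zero[OF E0, of \<delta>]] by simp
      fix a b :: real assume "a \<le> b"
      show "storage K w b - \<delta> * energy w b \<le> storage K w a - \<delta> * energy w a"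
      proof (rule nonincreasing_from_deriv[where f = "\<lambda>t. storage K w t - \<delta> * energy w t", OF _ _ \<open>a \<le> b\<close>])
        show "((\<lambda>t. storage K w t - \<delta> * energy w t) has_real_derivative storage F w t - \<delta> * E' t) (at t)" for t
          by (intro DERIV_diff DERIV_cmult deriv w E')
        have "- E' t \<le> cE * energy w t" for t
          using E'(2)[of t] by linarith
        then have "\<delta> * (- E' t) \<le> \<delta> * (cE * energy w t)" for t
          using \<delta>(1) by (intro mult_left_mono) auto
        moreover have "\<delta> * cE * energy w t \<le> e * energy w t" for t
          using \<delta>(2) energy_nonneg by (intro mult_right_mono)
        ultimately show "storage F w t - \<delta> * E' t \<le> 0" for t
          using e(2)[of w t] by (smt (verit) mult.assoc mult_minus_left mult_minus_right)
      qed
    qed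
    then show ?thesis by simp
  qed
  have nonneg: "0 \<le> storage K w t" if "w \<in> behaviour R" for w t
    using coercive[OF that, of t] energy_nonneg[of w t] \<delta>(1) by (smt (verit) mult_nonneg_nonneg)
  have decay: "exp (c * b) * storage K w b \<le> exp (c * a) * storage K w a"
    if w: "w \<in> behaviour R" and "a \<le> b" for w a b
  proof (rule nonincreasing_from_deriv[where f = "\<lambda>t. exp (c * t) * storage K w t", OF _ _ \<open>a \<le> b\<close>])
    show "((\<lambda>t. exp (c * t) * storage K w t) has_real_derivative
        exp (c * t) * (c * storage K w t + storage F w t)) (at t)" for t
      by (auto intro!: derivative_eq_intros deriv[OF w] simp: algebra_simps)
    show "exp (c * t) * (c * storage K w t + storage F w t) \<le> 0" for t
    proof -
      have "c * storage K w t \<le> c * (cK * energy w t)"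
        using cK(2)[of w t] c(1) by (intro mult_left_mono) auto
      also have "\<dots> \<le> e * energy w t"
        using mult_right_mono[OF c(2) energy_nonneg[of w t]] by (simp add: mult.assoc)
      finally have "c * storage K w t + storage F w t \<le> 0"
        using e(2)[of w t] by simp
      then show ?thesis
        by (simp add: mult_nonneg_nonpos)
    qed
  qed
  have "(w t $ j)\<^sup>2 \<le> (B / \<delta>) * storage K w t" if w: "w \<in> behaviour R" and j: "j < wd" for w t j
  proof -
    have "(w t $ j)\<^sup>2 \<le> (B / \<delta>) * (\<delta> * energy w t)"
      using B(2)[OF w j, of t] \<delta>(1) by simp
    also have "\<dots> \<le> (B / \<delta>) * storage K w t"
      using coercive[OF w] B(1) \<delta>(1) by (intro mult_left_mono) auto
    finally show ?thesis .
  qed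
  moreover have "B / \<delta> \<ge> 0"
    using B(1) \<delta>(1) by simp
  ultimately show ?thesis
    using c(1) nonneg decay by blast
qed

text \<open>Negative definiteness forces the state to be zero at that instant, and the trajectory's
  value is a linear function of the state.\<close>

lemma storage_zero_imp_zero:
  assumes F: "F \<in> carrier_mat n n" "neg_def F" and w: "w \<in> behaviour R" and 0: "storage F w t = 0"
  shows "w t = 0\<^sub>v wd"
proof -
  obtain e where e: "e > 0" "storage F w t \<le> - e * energy w t"
    using storage_neg_def[OF F] by blast
  obtain B where B: "\<And>j. j < wd \<Longrightarrow> (w t $ j)\<^sup>2 \<le> B * energy w t"
    using energy_dominates w by blast
  have "e * energy w t \<le> 0"
    using e 0 by simp
  then have "energy w t = 0"
    using energy_nonneg[of w t] e(1) by (simp add: mult_le_0_iff)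
  then have "w t $ j = 0" if "j < wd" for j
    using B[OF that] by simp
  then show ?thesis
    using w by (intro eq_vecI) (auto simp: behaviour_def)
qed

lemma storage_neg_def_nonpos:
  assumes F: "F \<in> carrier_mat n n" "neg_def F"
  shows "storage F w t \<le> 0"
proof -
  obtain e where "e > 0" "storage F w t \<le> - e * energy w t"
    using storage_neg_def[OF F] by blast
  then show ?thesis
    using mult_nonneg_nonneg[of e "energy w t"] energy_nonneg[of w t] by linarith
qed

lemma gluing_value:
  assumes "dim_col G = wd" "M \<in> carrier_mat (dim_row G) n" "pmat_mod G R = const_pmat M * X"
    and w: "w \<in> behaviour R"
  shows "pdo G w t = M *\<^sub>v pdo X w t"
proof (rule eq_vecI)
  fix i assume "i < dim_vec (M *\<^sub>v pdo X w t)"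
  then have i: "i < dim_row G" using assms(2) by simp
  have "pdo G w t $ i = (\<Sum>a<n. M $$ (i, a) * pdo X w t $ a)"
    using decomp_behaviour[OF decomp_pmat_mod[OF assms(1-3) i] w, of t] i assms(1)
    by (simp add: pdo_index)
  also have "\<dots> = (M *\<^sub>v pdo X w t) $ i"
    using mat_vec_index_sum[OF assms(2) pdo_X_carrier(1) i] by simp
  finally show "pdo G w t $ i = (M *\<^sub>v pdo X w t) $ i" .
qed (use assms in auto)

end

subsection \<open>Switched trajectories\<close>

text \<open>The signal is locally constant on the connected set \<open>A\<close>. At the left end
  \<open>a\<close>, which may itself be a switching instant, right-continuity is enough because
  \<open>A\<close> lies to its right.\<close>

lemma switching_signal_const:
  assumes s: "switching_signal N s" and A: "connected A" "a \<in> A" "A \<subseteq> {a..}" "x \<in> A"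
    and no: "switch_points s \<inter> (A - {a}) = {}"
  shows "s x = s a"
proof (rule connected_local_const[OF A(1,4,2), of s])
  show "\<forall>y\<in>A. eventually (\<lambda>z. s y = s z) (at y within A)"
  proof
    fix y assume y: "y \<in> A"
    show "eventually (\<lambda>z. s y = s z) (at y within A)"
    proof (cases "y = a")
      case True
      obtain e where e: "e > 0" "\<And>x. a \<le> x \<and> x < a + e \<Longrightarrow> s x = s a"
        using s unfolding switching_signal_def by blast
      have "s y = s z" if "z \<in> A" "dist z y < e" for z
        using e(2)[of z] A(3) that True by (auto simp: dist_real_def)
      then show ?thesis
        using e(1) unfolding eventually_at by blast
    next
      case False
      then have "y \<notin> switch_points s"
        using no y by auto
      then obtain e where e: "e > 0" "\<And>x. \<bar>x - y\<bar> < e \<Longrightarrow> s x = s y"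
        unfolding switch_points_def by blast
      have "s y = s z" if "dist z y < e" for z
        using e(2)[of z] that by (simp add: dist_real_def)
      then show ?thesis
        using e(1) unfolding eventually_at by blast
    qed
  qed
qed

text \<open>Equal values would make the signal constant on both sides of \<tau>, by absence of
  switches before it and right-continuity after it. Re-initialisation maps exist only between
  different modes, so this is needed to use them.\<close>

lemma switch_point_jump:
  assumes s: "switching_signal N s" and \<tau>: "\<tau> \<in> switch_points s" and t: "t < \<tau>"
    and no: "switch_points s \<inter> {t<..<\<tau>} = {}"
  shows "s t \<noteq> s \<tau>"
proof
  assume eq: "s t = s \<tau>"
  obtain e where e: "e > 0" "\<And>x. \<tau> \<le> x \<and> x < \<tau> + e \<Longrightarrow> s x = s \<tau>"
    using s unfolding switching_signal_def by blast
  have left: "s x = s \<tau>" if "t \<le> x" "x < \<tau>" for x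
  proof -
    have "{t..<\<tau>} - {t} = {t<..<\<tau>}" by auto
    then have "s x = s t"
      using that no t by (intro switching_signal_const[OF s, of "{t..<\<tau>}"]) auto
    then show ?thesis using eq by simp
  qed
  have "s x = s \<tau>" if "\<bar>x - \<tau>\<bar> < min e (\<tau> - t)" for x
  proof (cases "x < \<tau>")
    case True
    then show ?thesis using that by (intro left) auto
  next
    case False
    then show ?thesis using that by (intro e(2)) auto
  qed
  moreover have "min e (\<tau> - t) > 0"
    using e(1) t by simp
  ultimately show False
    using \<tau> unfolding switch_points_def by blast
qed

text \<open>Here \<open>q t u\<close> is the value at time \<open>u\<close> of the function
  belonging to the piece active at \<open>t\<close>. Induction on the number of switching instants
  in the interval, peeling off the last one.\<close>

lemma nonincreasing_across_jumps:
  fixes q :: "real \<Rightarrow> real \<Rightarrow> real"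
  assumes fin: "\<And>a b. finite (P \<inter> {a..b})"
    and decay: "\<And>t a b. a \<le> b \<Longrightarrow> q t b \<le> q t a"
    and same: "\<And>t t'. t < t' \<Longrightarrow> P \<inter> {t<..t'} = {} \<Longrightarrow> q t = q t'"
    and jump: "\<And>\<tau> t. \<tau> \<in> P \<Longrightarrow> t < \<tau> \<Longrightarrow> P \<inter> {t<..<\<tau>} = {} \<Longrightarrow> q \<tau> \<tau> \<le> q t \<tau>"
    and "a \<le> b"
  shows "q b b \<le> q a a"
  using \<open>a \<le> b\<close>
proof (induction "card (P \<inter> {a<..b})" arbitrary: b rule: less_induct)
  case less
  have no_switch: "q v v \<le> q u u" if "u \<le> v" "P \<inter> {u<..v} = {}" for u v
  proof (cases "u = v")
    case False
    then have "q v = q u"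
      using same[of u v] that by auto
    then show ?thesis
      using decay[OF that(1)] by simp
  qed simp
  have fin': "finite (P \<inter> {a<..b})" "finite (P \<inter> {a<..<x})" for x
    using finite_subset[OF _ fin[of a b]] finite_subset[OF _ fin[of a x]] by (auto simp: subset_iff)
  show ?case
  proof (cases "P \<inter> {a<..b} = {}")
    case True
    then show ?thesis
      using no_switch less.prems by simp
  next
    case False
    define \<tau> where "\<tau> = Max (P \<inter> {a<..b})"
    have \<tau>: "\<tau> \<in> P" "a < \<tau>" "\<tau> \<le> b"
      using Max_in[OF fin'(1) False] by (auto simp: \<tau>_def)
    have "x \<le> \<tau>" if "x \<in> P" "a < x" "x \<le> b" for x
      unfolding \<tau>_def using that by (intro Max_ge fin') auto
    then have "P \<inter> {\<tau><..b} = {}"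
      using \<tau>(2) by force
    then have 1: "q b b \<le> q \<tau> \<tau>"
      using no_switch \<tau>(3) by simp
    \<comment> \<open>The preceding switching instant, or \<open>a\<close> if there is none: the
      start of the piece that ends at \<tau>.\<close>
    define t where "t = Max (insert a (P \<inter> {a<..<\<tau>}))"
    have "t \<in> insert a (P \<inter> {a<..<\<tau>})"
      unfolding t_def by (intro Max_in) (auto simp: fin')
    then have t: "a \<le> t" "t < \<tau>"
      using \<tau>(2) by auto
    have "x \<le> t" if "x \<in> P" "a < x" "x < \<tau>" for x
      unfolding t_def using that by (intro Max_ge) (auto simp: fin')
    then have "P \<inter> {t<..<\<tau>} = {}"
      using t(1) by force
    then have 2: "q \<tau> \<tau> \<le> q t \<tau>"
      using jump \<tau>(1) t(2) by blast
    have 3: "q t \<tau> \<le> q t t"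
      using decay t(2) by simp
    have "\<tau> \<in> P \<inter> {a<..b}" "\<tau> \<notin> P \<inter> {a<..t}" "P \<inter> {a<..t} \<subseteq> P \<inter> {a<..b}"
      using \<tau> t by auto
    then have "P \<inter> {a<..t} \<subset> P \<inter> {a<..b}"
      by blast
    then have "q t t \<le> q a a"
      using less.hyps[OF psubset_card_mono[OF fin'(1)] t(1)] by blast
    with 1 2 3 show ?thesis by linarith
  qed
qed

text \<open>A decay rate may be lowered, since the correcting factor
  \<open>exp ((c' - c) * t)\<close> is nonincreasing. This brings all modes to a common
  rate.\<close>

lemma exp_decay_mono:
  fixes f :: "real \<Rightarrow> real"
  assumes "exp (c * b) * f b \<le> exp (c * a) * f a" "c' \<le> c" "a \<le> b" "0 \<le> f a"
  shows "exp (c' * b) * f b \<le> exp (c' * a) * f a"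
proof -
  have "exp (c' * b) * f b = exp ((c' - c) * b) * (exp (c * b) * f b)"
    by (simp add: mult.assoc[symmetric] exp_add[symmetric] left_diff_distrib)
  also have "\<dots> \<le> exp ((c' - c) * b) * (exp (c * a) * f a)"
    using assms(1) by (intro mult_left_mono) auto
  also have "\<dots> \<le> exp ((c' - c) * a) * (exp (c * a) * f a)"
    using assms by (intro mult_right_mono) (auto simp: mult_left_mono_neg)
  also have "\<dots> = exp (c' * a) * f a"
    by (simp add: mult.assoc[symmetric] exp_add[symmetric] left_diff_distrib)
  finally show ?thesis .
qed

lemma tends_to_zero_if_exp_bound:
  fixes f :: "real \<Rightarrow> real"
  assumes "c > 0" "\<And>t. t \<ge> 0 \<Longrightarrow> (f t)\<^sup>2 \<le> M * exp (- c * t)"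
  shows "(f \<longlongrightarrow> 0) at_top"
proof -
  have "filterlim (\<lambda>t. c * t) at_top at_top"
    by (rule filterlim_tendsto_pos_mult_at_top[OF tendsto_const assms(1) filterlim_ident])
  then have "filterlim (\<lambda>t. - (c * t)) at_bot at_top"
    by (simp add: filterlim_uminus_at_top)
  then have "((\<lambda>t. exp (- (c * t))) \<longlongrightarrow> 0) at_top"
    by (rule filterlim_compose[OF exp_at_bot])
  then have lim: "((\<lambda>t. M * exp (- c * t)) \<longlongrightarrow> 0) at_top"
    using tendsto_mult_right_zero[of _ _ M] by simp
  have "eventually (\<lambda>t. (f t)\<^sup>2 \<le> M * exp (- c * t)) at_top"
    using assms(2) by (rule eventually_at_top_linorderI)
  then have "((\<lambda>t. (f t)\<^sup>2) \<longlongrightarrow> 0) at_top"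
    by (rule tendsto_sandwich[OF always_eventually _ tendsto_const lim, OF allI[OF zero_le_power2]])
  from tendsto_real_sqrt[OF this] have "((\<lambda>t. \<bar>f t\<bar>) \<longlongrightarrow> 0) at_top"
    by simp
  then show ?thesis
    by (rule tendsto_rabs_zero_cancel)
qed

text \<open>With one rate for all modes, the exponentially weighted Lyapunov value is nonincreasing
  inside modes and across switches, so it stays below its value at time 0; no dwell time
  enters.\<close>

lemma switched_lyapunov_stable:
  fixes Q :: "nat \<Rightarrow> traj \<Rightarrow> real \<Rightarrow> real"
  assumes mode: "\<And>k. k \<in> {1..N} \<Longrightarrow> \<exists>c>0. \<exists>B\<ge>0. \<forall>w\<in>behaviour (R k).
      (\<forall>t. 0 \<le> Q k w t) \<and>
      (\<forall>a b. a \<le> b \<longrightarrow> exp (c * b) * Q k w b \<le> exp (c * a) * Q k w a) \<and>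
      (\<forall>t. \<forall>j<wd. (w t $ j)\<^sup>2 \<le> B * Q k w t)"
    and jump: "\<And>s W w \<tau> t. sw_traj N R Gm Gp s W w \<Longrightarrow> \<tau> \<in> switch_points s \<Longrightarrow> t < \<tau> \<Longrightarrow>
      switch_points s \<inter> {t<..<\<tau>} = {} \<Longrightarrow> Q (s \<tau>) (W \<tau>) \<tau> \<le> Q (s t) (W t) \<tau>"
  shows "sw_asympt_stable wd N R Gm Gp"
  unfolding sw_asympt_stable_def tends_to_zero_def
proof (intro ballI allI impI)
  fix w j assume "w \<in> switched_behaviour N R Gm Gp" and j: "j < wd"
  then obtain s W where sw: "sw_traj N R Gm Gp s W w"
    unfolding switched_behaviour_def by blast
  have sig: "switching_signal N s" and Wb: "\<And>t. W t \<in> behaviour (R (s t))"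
    and same: "\<And>t t'. t < t' \<Longrightarrow> switch_points s \<inter> {t<..t'} = {} \<Longrightarrow> W t = W t'"
    and w: "\<And>t. w t = W t t"
    using sw unfolding sw_traj_def by blast+
  have sN: "s t \<in> {1..N}" for t
    using sig unfolding switching_signal_def by blast
  have fin: "finite (switch_points s \<inter> {a..b})" for a b
    using sig unfolding switching_signal_def by blast
  define good where "good k c B \<longleftrightarrow> c > 0 \<and> B \<ge> 0 \<and> (\<forall>w\<in>behaviour (R k).
      (\<forall>t. 0 \<le> Q k w t) \<and>
      (\<forall>a b. a \<le> b \<longrightarrow> exp (c * b) * Q k w b \<le> exp (c * a) * Q k w a) \<and>
      (\<forall>t. \<forall>j<wd. (w t $ j)\<^sup>2 \<le> B * Q k w t))" for k c B
  have "\<exists>c B. good k c B" if "k \<in> {1..N}" for k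
    using mode[OF that] unfolding good_def by (elim exE conjE) (intro exI conjI; assumption)
  then obtain c B where good: "\<And>k. k \<in> {1..N} \<Longrightarrow> good k (c k) (B k)"
    by metis
  have c: "c k > 0" and B: "B k \<ge> 0" if "k \<in> {1..N}" for k
    using good[OF that] unfolding good_def by auto
  have Q0: "0 \<le> Q (s t) (W t) u" for t u
    using good[OF sN[of t]] Wb[of t] unfolding good_def by simp
  have decay: "exp (c (s t) * v) * Q (s t) (W t) v \<le> exp (c (s t) * u) * Q (s t) (W t) u"
    if "u \<le> v" for t u v
    using good[OF sN[of t]] Wb[of t] that unfolding good_def by simp
  have bound: "(W t u $ j)\<^sup>2 \<le> B (s t) * Q (s t) (W t) u" for t u
    using good[OF sN[of t]] Wb[of t] j unfolding good_def by simp
  \<comment> \<open>Finitely many modes: the slowest rate and the sum of the bounds serve all of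
    them.\<close>
  define c0 where "c0 = Min (c ` {1..N})"
  define B0 where "B0 = (\<Sum>k\<in>{1..N}. B k)"
  have ne: "{1..N} \<noteq> {}"
    using sN by blast
  have c0: "c0 > 0"
    unfolding c0_def using c ne by (subst Min_gr_iff) auto
  have c0_le: "c0 \<le> c k" if "k \<in> {1..N}" for k
    unfolding c0_def using that by (intro Min_le) auto
  have B0_ge: "B k \<le> B0" if "k \<in> {1..N}" for k
    unfolding B0_def using that B by (intro member_le_sum) auto
  define q where "q t u = exp (c0 * u) * Q (s t) (W t) u" for t u
  have q_decay: "q t v \<le> q t u" if "u \<le> v" for t u v
    unfolding q_def
    by (rule exp_decay_mono[where f = "Q (s t) (W t)", OF decay[OF that] c0_le[OF sN] that Q0])
  have q_same: "q t = q t'" if "t < t'" "switch_points s \<inter> {t<..t'} = {}" for t t'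
  proof -
    have "{t..t'} - {t} = {t<..t'}" by auto
    then have "s t' = s t"
      using that by (intro switching_signal_const[OF sig, of "{t..t'}"]) auto
    then show ?thesis
      using same[OF that] by (intro ext) (simp add: q_def)
  qed
  have q_jump: "q \<tau> \<tau> \<le> q t \<tau>"
    if "\<tau> \<in> switch_points s" "t < \<tau>" "switch_points s \<inter> {t<..<\<tau>} = {}" for \<tau> t
    unfolding q_def using jump[OF sw that] by simp
  have q0: "q t t \<le> q 0 0" if "t \<ge> 0" for t
    by (rule nonincreasing_across_jumps[where q = q and P = "switch_points s",
          OF fin q_decay q_same q_jump that])
  have "(w t $ j)\<^sup>2 \<le> B0 * q 0 0 * exp (- c0 * t)" if "t \<ge> 0" for t
  proof -
    have B0: "0 \<le> B0"
      using B0_ge[OF sN[of t]] B[OF sN[of t]] by linarith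
    have "(w t $ j)\<^sup>2 \<le> B (s t) * Q (s t) (W t) t"
      unfolding w by (rule bound)
    also have "\<dots> \<le> B0 * Q (s t) (W t) t"
      using B0_ge[OF sN] Q0 by (intro mult_right_mono)
    also have "B0 * Q (s t) (W t) t = B0 * (q t t * exp (- c0 * t))"
      by (simp add: q_def exp_minus field_simps)
    also have "\<dots> \<le> B0 * (q 0 0 * exp (- c0 * t))"
      using q0[OF that] B0 by (intro mult_left_mono mult_right_mono) auto
    finally show ?thesis
      by (simp add: mult.assoc)
  qed
  then show "((\<lambda>t. w t $ j) \<longlongrightarrow> 0) at_top"
    by (rule tends_to_zero_if_exp_bound[OF c0])
qed

section \<open>The Lyapunov theorem for the switched system\<close>

theorem theorem3:
  fixes N wd :: nat
    and R X :: "nat \<Rightarrow> real poly mat"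
    and Gm Gp :: "nat \<Rightarrow> nat \<Rightarrow> real poly mat"
    and Fm Fp Finv :: "nat \<Rightarrow> nat \<Rightarrow> real mat"
    and lam :: "nat \<Rightarrow> nat \<Rightarrow> complex"
    and wv :: "nat \<Rightarrow> nat \<Rightarrow> complex vec"
    and K Y :: "nat \<Rightarrow> real mat"
  defines "n \<equiv> \<lambda>k. degree (det (R k))"
    and "Lmap \<equiv> \<lambda>k l. Finv k l * Fm k l"
  assumes modes: "\<And>k. k \<in> {1..N} \<Longrightarrow> R k \<in> carrier_mat wd wd \<and> det (R k) \<noteq> 0
                        \<and> beh_asympt_stable (R k)"
    and state_map: "\<And>k. k \<in> {1..N} \<Longrightarrow> minimal_state_map (X k) (R k)"
    and roots: "\<And>k z. k \<in> {1..N} \<Longrightarrow>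
        card {i. i < n k \<and> lam k i = z} = Polynomial.order z (map_poly complex_of_real (det (R k)))"
    and mult: "\<And>k i. k \<in> {1..N} \<Longrightarrow> i < n k \<Longrightarrow>
        Polynomial.order (lam k i) (map_poly complex_of_real (det (R k))) = kernel_dim (peval_c (R k) (lam k i))"
    and wvec: "\<And>k i. k \<in> {1..N} \<Longrightarrow> i < n k \<Longrightarrow>
        wv k i \<in> carrier_vec wd \<and> peval_c (R k) (lam k i) *\<^sub>v wv k i = 0\<^sub>v wd"
    and windep: "\<And>k z c. k \<in> {1..N} \<Longrightarrow>
        (\<forall>a<wd. (\<Sum>i | i < n k \<and> lam k i = z. c i * wv k i $ a) = 0) \<Longrightarrow>
        (\<forall>i. i < n k \<and> lam k i = z \<longrightarrow> c i = 0)"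
    and gluing: "\<And>k l. k \<in> {1..N} \<Longrightarrow> l \<in> {1..N} \<Longrightarrow> k \<noteq> l \<Longrightarrow>
        dim_col (Gm k l) = wd \<and> dim_col (Gp k l) = wd \<and> dim_row (Gp k l) = dim_row (Gm k l)"
    and Fm_def: "\<And>k l. k \<in> {1..N} \<Longrightarrow> l \<in> {1..N} \<Longrightarrow> k \<noteq> l \<Longrightarrow>
        Fm k l \<in> carrier_mat (dim_row (Gm k l)) (n k) \<and>
        pmat_mod (Gm k l) (R k) = const_pmat (Fm k l) * X k"
    and Fp_def: "\<And>k l. k \<in> {1..N} \<Longrightarrow> l \<in> {1..N} \<Longrightarrow> k \<noteq> l \<Longrightarrow>
        Fp k l \<in> carrier_mat (dim_row (Gp k l)) (n l) \<and>
        pmat_mod (Gp k l) (R l) = const_pmat (Fp k l) * X l"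
    and well_posed: "\<And>k l vk v v'. k \<in> {1..N} \<Longrightarrow> l \<in> {1..N} \<Longrightarrow> k \<noteq> l \<Longrightarrow>
        vk \<in> carrier_vec (n k) \<Longrightarrow> v \<in> carrier_vec (n l) \<Longrightarrow> v' \<in> carrier_vec (n l) \<Longrightarrow>
        Fm k l *\<^sub>v vk = Fp k l *\<^sub>v v \<Longrightarrow> Fm k l *\<^sub>v vk = Fp k l *\<^sub>v v' \<Longrightarrow> v = v'"
    and left_inv: "\<And>k l. k \<in> {1..N} \<Longrightarrow> l \<in> {1..N} \<Longrightarrow> k \<noteq> l \<Longrightarrow>
        Finv k l \<in> carrier_mat (n l) (dim_row (Gp k l)) \<and> Finv k l * Fp k l = 1\<^sub>m (n l)"
    and KY: "\<And>k. k \<in> {1..N} \<Longrightarrow> K k \<in> carrier_mat (n k) (n k) \<and> Y k \<in> carrier_mat wd (n k)"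
    and LMI: "\<And>k. k \<in> {1..N} \<Longrightarrow> neg_semidef (Phi_tilde (R k) (X k) (K k) (Y k))"
  shows "(\<exists>F. \<forall>k\<in>{1..N}. F k \<in> carrier_mat (n k) (n k) \<and>
            Phi_tilde (R k) (X k) (K k) (Y k) = blk_XT0 (R k) (X k) * F k * blk_X0 (R k) (X k))
       \<and> (\<forall>F. (\<forall>k\<in>{1..N}. F k \<in> carrier_mat (n k) (n k) \<and>
               Phi_tilde (R k) (X k) (K k) (Y k) = blk_XT0 (R k) (X k) * F k * blk_X0 (R k) (X k))
            \<longrightarrow> (\<forall>k\<in>{1..N}. neg_def (F k))
            \<longrightarrow> (\<forall>k\<in>{1..N}. \<forall>l\<in>{1..N}. l \<noteq> k \<longrightarrow>
                  herm_geq
                    (mat_adjoint (Vmat (X k) (lam k) (wv k)) * cmat (K k) * Vmat (X k) (lam k) (wv k))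
                    (mat_adjoint (Vmat (X k) (lam k) (wv k)) * cmat (transpose_mat (Lmap k l))
                       * cmat (K l) * cmat (Lmap k l) * Vmat (X k) (lam k) (wv k)))
            \<longrightarrow> sw_asympt_stable wd N R Gm Gp
                \<and> multiple_lyapunov N R Gm Gp (\<lambda>k. psi_X (X k) (K k)) (\<lambda>k. pmat_degree (X k)))"

proof (intro conjI allI impI)
  have st: "state_map (R k) (X k) wd" if "k \<in> {1..N}" for k
    using modes[OF that] state_map[OF that] by (simp add: state_map_def)
  have K: "K k \<in> carrier_mat (degree (det (R k))) (degree (det (R k)))"
    and Y: "Y k \<in> carrier_mat wd (degree (det (R k)))" if "k \<in> {1..N}" for k
    using KY[OF that] by (simp_all add: n_def)
  show "\<exists>F. \<forall>k\<in>{1..N}. F k \<in> carrier_mat (n k) (n k) \<and>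
            Phi_tilde (R k) (X k) (K k) (Y k) = blk_XT0 (R k) (X k) * F k * blk_X0 (R k) (X k)"
  proof (rule bchoice, rule ballI)
    fix k assume k: "k \<in> {1..N}"
    show "\<exists>F. F \<in> carrier_mat (n k) (n k) \<and>
            Phi_tilde (R k) (X k) (K k) (Y k) = blk_XT0 (R k) (X k) * F * blk_X0 (R k) (X k)"
      using state_map.Phi_factor[OF st[OF k] K[OF k] Y[OF k] LMI[OF k]] unfolding n_def Bex_def .
  qed

  fix F
  assume F_all: "\<forall>k\<in>{1..N}. F k \<in> carrier_mat (n k) (n k) \<and>
               Phi_tilde (R k) (X k) (K k) (Y k) = blk_XT0 (R k) (X k) * F k * blk_X0 (R k) (X k)"
    and neg_all: "\<forall>k\<in>{1..N}. neg_def (F k)"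
    and geq: "\<forall>k\<in>{1..N}. \<forall>l\<in>{1..N}. l \<noteq> k \<longrightarrow>
                  herm_geq
                    (mat_adjoint (Vmat (X k) (lam k) (wv k)) * cmat (K k) * Vmat (X k) (lam k) (wv k))
                    (mat_adjoint (Vmat (X k) (lam k) (wv k)) * cmat (transpose_mat (Lmap k l))
                       * cmat (K l) * cmat (Lmap k l) * Vmat (X k) (lam k) (wv k))"
  have F: "F k \<in> carrier_mat (degree (det (R k))) (degree (det (R k)))"
    and Phi: "Phi_tilde (R k) (X k) (K k) (Y k) = blk_XT0 (R k) (X k) * F k * blk_X0 (R k) (X k)"
    and neg: "neg_def (F k)" if "k \<in> {1..N}" for k
    using F_all neg_all that by (auto simp: n_def)
  define Q where "Q k = qdf (psi_X (X k) (K k)) (pmat_degree (X k))" for k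
  have Q: "Q k w = state_map.storage (X k) (K k) w" if "k \<in> {1..N}" "w \<in> behaviour (R k)" for k w
    unfolding Q_def by (intro ext state_map.qdf_psi_X[OF st[OF that(1)] K[OF that(1)] that(2)])
  have mode: "\<exists>c>0. \<exists>B\<ge>0. \<forall>w\<in>behaviour (R k).
      (\<forall>t. 0 \<le> Q k w t) \<and>
      (\<forall>a b. a \<le> b \<longrightarrow> exp (c * b) * Q k w b \<le> exp (c * a) * Q k w a) \<and>
      (\<forall>t. \<forall>j<wd. (w t $ j)\<^sup>2 \<le> B * Q k w t)" if k: "k \<in> {1..N}" for k
  proof -
    have "beh_asympt_stable (R k)"
      using modes[OF k] by blast
    from state_map.mode_lyapunov[OF st[OF k] this K[OF k] Y[OF k] F[OF k] Phi[OF k] neg[OF k]]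
    show ?thesis
      using Q[OF k] by simp
  qed
  have rderiv_Q: "rderiv (Q k w) t = state_map.storage (X k) (F k) w t"
    if "k \<in> {1..N}" "w \<in> behaviour (R k)" for k w t
    unfolding Q[OF that]
    by (rule rderiv_eq[OF state_map.storage_has_derivative[OF st K Y F Phi that(2)]]) (rule that(1))+
  \<comment> \<open>The gluing condition determines the new state from the old one, and the
    inequality with \<open>V\<close> compares the two storages.\<close>
  have jump: "Q (s \<tau>) (W \<tau>) \<tau> \<le> Q (s t) (W t) \<tau>"
    if sw: "sw_traj N R Gm Gp s W w" and \<tau>: "\<tau> \<in> switch_points s" "t < \<tau>"
      "switch_points s \<inter> {t<..<\<tau>} = {}" for s W w \<tau> t
  proof -
    have sig: "switching_signal N s" and W: "\<And>t. W t \<in> behaviour (R (s t))"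
      and glue: "pdo (Gp (s t) (s \<tau>)) (W \<tau>) \<tau> = pdo (Gm (s t) (s \<tau>)) (W t) \<tau>"
      using sw \<tau> unfolding sw_traj_def by blast+
    define k where "k = s t"
    define l where "l = s \<tau>"
    have k: "k \<in> {1..N}" and l: "l \<in> {1..N}"
      using sig unfolding switching_signal_def k_def l_def by blast+
    have kl: "k \<noteq> l"
      unfolding k_def l_def by (rule switch_point_jump[OF sig \<tau>])
    have Wk: "W t \<in> behaviour (R k)" and Wl: "W \<tau> \<in> behaviour (R l)"
      using W by (simp_all add: k_def l_def)
    define x where "x = pdo (X k) (W t) \<tau>"
    define y where "y = pdo (X l) (W \<tau>) \<tau>"
    have x: "x \<in> carrier_vec (n k)" and y: "y \<in> carrier_vec (n l)"
      unfolding x_def y_def n_def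
      by (rule state_map.pdo_X_carrier[OF st[OF k]], rule state_map.pdo_X_carrier[OF st[OF l]])
    have Fm: "Fm k l \<in> carrier_mat (dim_row (Gm k l)) (n k)" "pmat_mod (Gm k l) (R k) = const_pmat (Fm k l) * X k"
      and Fp: "Fp k l \<in> carrier_mat (dim_row (Gp k l)) (n l)" "pmat_mod (Gp k l) (R l) = const_pmat (Fp k l) * X l"
      and Finv: "Finv k l \<in> carrier_mat (n l) (dim_row (Gp k l))" "Finv k l * Fp k l = 1\<^sub>m (n l)"
      and G: "dim_col (Gm k l) = wd" "dim_col (Gp k l) = wd" "dim_row (Gp k l) = dim_row (Gm k l)"
      using Fm_def[OF k l kl] Fp_def[OF k l kl] left_inv[OF k l kl] gluing[OF k l kl] by auto
    have "Fp k l *\<^sub>v y = Fm k l *\<^sub>v x"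
      using state_map.gluing_value[OF st[OF k] G(1) Fm[unfolded n_def] Wk, of \<tau>]
        state_map.gluing_value[OF st[OF l] G(2) Fp[unfolded n_def] Wl, of \<tau>] glue
      by (simp add: x_def y_def k_def l_def)
    \<comment> \<open>Cancelling \<open>Fp\<close> by its left inverse gives
      \<open>y = L x\<close>.\<close>
    then have "(Finv k l * Fp k l) *\<^sub>v y = (Finv k l * Fm k l) *\<^sub>v x"
      using assoc_mult_mat_vec[OF Finv(1) Fp(1) y] assoc_mult_mat_vec[OF Finv(1) Fm(1)[folded G(3)] x]
      by simp
    then have yx: "y = Lmap k l *\<^sub>v x"
      using y by (simp add: Finv(2) Lmap_def)
    have L: "Lmap k l \<in> carrier_mat (n l) (n k)"
      unfolding Lmap_def using Finv(1) Fm(1) G(3) by (metis mult_carrier_mat)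
    have "cvec x \<in> carrier_vec (degree (det (R k)))"
      using x by (simp add: n_def)
    \<comment> \<open>The real state is a complex combination of the columns of \<open>V\<close>,
      which span the whole space.\<close>
    then obtain z where z: "z \<in> carrier_vec (n k)" "Vmat (X k) (lam k) (wv k) *\<^sub>v z = cvec x"
      using state_map.Vmat_surj[OF st[OF k] wvec[OF k, unfolded n_def] windep[OF k, unfolded n_def]]
      unfolding n_def by blast
    have V: "Vmat (X k) (lam k) (wv k) \<in> carrier_mat (n k) (n k)"
      using state_map.X[OF st[OF k]] by (simp add: Vmat_def n_def)
    have "y \<bullet> (K l *\<^sub>v y) \<le> x \<bullet> (K k *\<^sub>v x)"
      unfolding yx
      by (rule herm_geq_real_vec[OF V KY[OF k, THEN conjunct1] KY[OF l, THEN conjunct1] L x z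
            geq[rule_format, OF k l kl[symmetric]]])
    then have "Q l (W \<tau>) \<tau> \<le> Q k (W t) \<tau>"
      unfolding Q[OF k Wk] Q[OF l Wl] state_map.storage_def[OF st[OF k]] state_map.storage_def[OF st[OF l]]
        x_def y_def .
    then show ?thesis
      by (simp add: k_def l_def)
  qed
  show "sw_asympt_stable wd N R Gm Gp"
    by (rule switched_lyapunov_stable[OF mode jump])
  show "multiple_lyapunov N R Gm Gp (\<lambda>k. psi_X (X k) (K k)) (\<lambda>k. pmat_degree (X k))"
    unfolding multiple_lyapunov_def Q_def[symmetric]
  proof (intro conjI ballI allI impI)
    fix i w t assume i: "i \<in> {1..N}" and w: "w \<in> behaviour (R i)"
    show "0 \<le> Q i w t"
      using mode[OF i] w by blast
    show "rderiv (Q i w) t \<le> 0"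
      unfolding rderiv_Q[OF i w] by (rule state_map.storage_neg_def_nonpos[OF st[OF i] F[OF i] neg[OF i]])
  next
    fix i w t assume i: "i \<in> {1..N}" and w: "w \<in> behaviour (R i)" and "\<forall>t. rderiv (Q i w) t = 0"
    then have "state_map.storage (X i) (F i) w t = 0"
      by (simp add: rderiv_Q[OF i w])
    then show "w t = 0\<^sub>v (dim_col (R i))"
      using state_map.storage_zero_imp_zero[OF st[OF i] F[OF i] neg[OF i] w] modes[OF i] by auto
  next
    fix s W w \<tau> t
    assume "sw_traj N R Gm Gp s W w" "\<tau> \<in> switch_points s" "t < \<tau>" "switch_points s \<inter> {t<..<\<tau>} = {}"
    then show "Q (s \<tau>) (W \<tau>) \<tau> \<le> Q (s t) (W t) \<tau>"
      by (rule jump)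
  qed
qed

end
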